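(* Let $p > 3$ be a prime, let $V$ be a vector space over $\mathbb{Q}_p$ of dimension $d \geq 2$, let $W = V \wedge V$, and let $1 \leq r \leq \binom{d}{2}$. The decomposability map $$\Psi \colon \mathrm{Gr}(2,V)^r \dashrightarrow \mathrm{Gr}(r, W), \qquad (L_1, \dots, L_r) \mapsto \textstyle\bigwedge^2 L_1 \oplus \dots \oplus \bigwedge^2 L_r,$$ is a submersion on a dense open subset of its domain if and only if $r \geq \binom{d-2}{2} + 1$.
   Context: $\mathrm{Gr}(k,U)$ denotes the Grassmannian variety of $k$-dimensional subspaces of a finite-dimensional $\mathbb{Q}_p$-vector space $U$. The rational map $\Psi$ is defined on the Zariski dense open set of tuples $(L_1,\dots,L_r)$ for which the lines $\bigwedge^2 L_i \subset W$ are linearly independent; equivalently $\Psi(\langle x_1,y_1\rangle,\dots,\langle x_r,y_r\rangle) = \langle x_1\wedge y_1,\dots,x_r\wedge y_r\rangle$. "Submersion at a point" means that the differential of $\Psi$ at that point is surjective. "Dense open" is in the Zariski topology. *)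

theory Defs
  imports
    "HOL-Analysis.Abstract_Topology"
    "HOL-Computational_Algebra.Fraction_Field"
    "HOL-Library.Product_Plus"
    "HOL-Library.FuncSet"
    "Berlekamp_Zassenhaus.Finite_Field"
begin

section \<open>The field of p-adic numbers\<close>

text \<open>
  The prime is the cardinality of the type argument \<open>'p\<close>. The p-adic integers are the inverse limit
  of the rings of integers modulo \<open>p ^ n\<close>, each residue class being represented by its element
  in \<open>{0..<p ^ n}\<close>.
\<close>

typedef (overloaded) ('p::prime_card) padic_int =
  "{f :: nat \<Rightarrow> int. \<forall>n. f n = f (Suc n) mod int CARD('p) ^ n}"
  by (rule exI[of _ "\<lambda>_. 0"]) simp

setup_lifting type_definition_padic_int

lemma padic_mod_mod:
  "a mod (p :: int) ^ Suc n mod p ^ n = a mod p ^ n"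
  by (simp add: mod_mod_cancel)

instantiation padic_int :: (prime_card) idom
begin

lift_definition zero_padic_int :: "'a padic_int" is "\<lambda>n. 0" by simp
lift_definition one_padic_int :: "'a padic_int" is "\<lambda>n. 1 mod int CARD('a) ^ n"
  by (rule padic_mod_mod[symmetric])
lift_definition plus_padic_int :: "'a padic_int \<Rightarrow> 'a padic_int \<Rightarrow> 'a padic_int"
  is "\<lambda>f g n. (f n + g n) mod int CARD('a) ^ n"
  by (metis mod_add_eq padic_mod_mod)
lift_definition minus_padic_int :: "'a padic_int \<Rightarrow> 'a padic_int \<Rightarrow> 'a padic_int"
  is "\<lambda>f g n. (f n - g n) mod int CARD('a) ^ n"
  by (metis mod_diff_eq padic_mod_mod)
lift_definition uminus_padic_int :: "'a padic_int \<Rightarrow> 'a padic_int"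
  is "\<lambda>f n. (- f n) mod int CARD('a) ^ n"
  by (metis mod_minus_eq padic_mod_mod)
lift_definition times_padic_int :: "'a padic_int \<Rightarrow> 'a padic_int \<Rightarrow> 'a padic_int"
  is "\<lambda>f g n. (f n * g n) mod int CARD('a) ^ n"
  by (metis mod_mult_eq padic_mod_mod)

lemma Rep_padic_int_mod [simp]:
  "Rep_padic_int (x :: 'a padic_int) n mod int CARD('a) ^ n = Rep_padic_int x n"
proof -
  have "Rep_padic_int x n = Rep_padic_int x (Suc n) mod int CARD('a) ^ n"
    using Rep_padic_int[of x] by blast
  thus ?thesis by (metis mod_mod_trivial)
qed

lemma Rep_padic_int_mod_le:
  assumes "m \<le> n"
  shows "Rep_padic_int (x :: 'a padic_int) n mod int CARD('a) ^ m = Rep_padic_int x m"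
  using assms
proof (induction rule: dec_induct)
  case base
  show ?case by simp
next
  case (step n)
  have "Rep_padic_int x n = Rep_padic_int x (Suc n) mod int CARD('a) ^ n"
    using Rep_padic_int[of x] by blast
  with step show ?case
    by (metis le_imp_power_dvd mod_mod_cancel)
qed

lemma padic_int_eqI:
  "(\<And>n. Rep_padic_int x n = Rep_padic_int y n) \<Longrightarrow> x = y"
  by (metis Rep_padic_int_inject ext)

instance
proof
  fix a b c :: "'a padic_int"
  note reps = zero_padic_int.rep_eq one_padic_int.rep_eq plus_padic_int.rep_eq
    minus_padic_int.rep_eq uminus_padic_int.rep_eq times_padic_int.rep_eq
  show "a * b * c = a * (b * c)"
    by (rule padic_int_eqI) (simp add: reps mod_simps mult.assoc)
  show "a * b = b * a"
    by (rule padic_int_eqI) (simp add: reps mult.commute)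
  show "1 * a = a"
    by (rule padic_int_eqI) (simp add: reps mod_simps)
  show "a + b + c = a + (b + c)"
    by (rule padic_int_eqI) (simp add: reps mod_simps add.assoc)
  show "a + b = b + a"
    by (rule padic_int_eqI) (simp add: reps add.commute)
  show "0 + a = a"
    by (rule padic_int_eqI) (simp add: reps)
  show "- a + a = 0"
    by (rule padic_int_eqI) (simp add: reps mod_simps)
  show "a - b = a + - b"
    by (rule padic_int_eqI) (simp add: reps mod_simps)
  show "(a + b) * c = a * c + b * c"
    by (rule padic_int_eqI) (simp add: reps mod_simps distrib_right)
  show "a * (b + c) = a * b + a * c"
    by (rule padic_int_eqI) (simp add: reps mod_simps distrib_left)
  show "0 * a = 0" "a * 0 = 0"
    by (rule padic_int_eqI, simp add: reps)+
  have p: "prime CARD('a)" by (rule prime_card)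
  hence ge: "int CARD('a) > 1" using prime_gt_1_nat[OF p] by linarith
  have "Rep_padic_int (0 :: 'a padic_int) 1 \<noteq> Rep_padic_int 1 1"
    using ge by (simp add: reps)
  thus "(0 :: 'a padic_int) \<noteq> 1" by metis
  show "a * b \<noteq> 0" if a0: "a \<noteq> 0" and b0: "b \<noteq> 0"
  proof
    assume z: "a * b = 0"
    from a0 obtain m where m: "Rep_padic_int a m \<noteq> 0"
      by (metis padic_int_eqI zero_padic_int.rep_eq)
    from b0 obtain n where n: "Rep_padic_int b n \<noteq> 0"
      by (metis padic_int_eqI zero_padic_int.rep_eq)
    let ?A = "Rep_padic_int a (m + n)" and ?B = "Rep_padic_int b (m + n)"
    have "(?A * ?B) mod int CARD('a) ^ (m + n) = 0"
      using z by (metis times_padic_int.rep_eq zero_padic_int.rep_eq)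
    hence dvd: "int CARD('a) ^ (m + n) dvd ?A * ?B" by auto
    have nA: "\<not> int CARD('a) ^ m dvd ?A"
      using m Rep_padic_int_mod_le[of m "m + n" a] by auto
    have nB: "\<not> int CARD('a) ^ n dvd ?B"
      using n Rep_padic_int_mod_le[of n "m + n" b] by auto
    have nz: "?A \<noteq> 0" "?B \<noteq> 0" using nA nB by auto
    have pe: "prime_elem (int CARD('a))"
      using p by auto
    have nu: "\<not> is_unit (int CARD('a))" using ge by simp
    have "multiplicity (int CARD('a)) ?A < m"
      using nA multiplicity_dvd'[of m "int CARD('a)" ?A] by (meson leI)
    moreover have "multiplicity (int CARD('a)) ?B < n"
      using nB multiplicity_dvd'[of n "int CARD('a)" ?B] by (meson leI)
    moreover have "m + n \<le> multiplicity (int CARD('a)) (?A * ?B)"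
      using dvd nz nu by (simp add: power_dvd_iff_le_multiplicity)
    ultimately show False
      using prime_elem_multiplicity_mult_distrib[OF pe nz] by linarith
  qed
qed

end

type_synonym 'p padic = "'p padic_int fract"


section \<open>Dual numbers\<close>

datatype 'a dual = Dual (std: 'a) (inf: 'a)

instantiation dual :: (comm_ring_1) comm_ring_1
begin

definition "0 = Dual 0 0"
definition "1 = Dual 1 0"
definition "a + b = Dual (std a + std b) (inf a + inf b)"
definition "a - b = Dual (std a - std b) (inf a - inf b)"
definition "- a = Dual (- std a) (- inf a)"
definition "a * b = Dual (std a * std b) (std a * inf b + inf a * std b)"

instance
  by standard
    (auto simp: zero_dual_def one_dual_def plus_dual_def minus_dual_def uminus_dual_def
      times_dual_def algebra_simps)

end

text \<open>
  For a vector space \<open>U\<close> over \<open>K\<close>, the pair \<open>(u, u')\<close> stands for the element \<open>u + \<epsilon> u'\<close> of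
  \<open>U \<otimes> K[\<epsilon>]\<close>, where \<open>\<epsilon>\<^sup>2 = 0\<close>. Under \<open>\<And>\<^sup>2 (V \<otimes> K[\<epsilon>]) = (\<And>\<^sup>2 V) \<otimes> K[\<epsilon>]\<close> the wedge product extends
  bilinearly.
\<close>

definition dual_scale ::
  "('k \<Rightarrow> 'u \<Rightarrow> 'u) \<Rightarrow> 'k dual \<Rightarrow> 'u \<times> 'u \<Rightarrow> 'u \<times> 'u::plus" where
  "dual_scale s a u = (s (std a) (fst u), s (std a) (snd u) + s (inf a) (fst u))"

definition dual_wedge ::
  "('v \<Rightarrow> 'v \<Rightarrow> 'w::plus) \<Rightarrow> 'v \<times> 'v \<Rightarrow> 'v \<times> 'v \<Rightarrow> 'w \<times> 'w" where
  "dual_wedge wedge u v =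
     (wedge (fst u) (fst v), wedge (fst u) (snd v) + wedge (snd u) (fst v))"

lemma module_dual_scale:
  assumes "Modules.module s"
  shows "Modules.module (dual_scale s)"
proof -
  interpret Modules.module s by fact
  show ?thesis
    by standard
      (auto simp: dual_scale_def one_dual_def plus_dual_def times_dual_def
        scale_left_distrib scale_right_distrib algebra_simps)
qed


section \<open>Exterior squares\<close>

definition alternating_bilinear ::
  "('k::field \<Rightarrow> 'v::ab_group_add \<Rightarrow> 'v) \<Rightarrow> ('k \<Rightarrow> 'u::ab_group_add \<Rightarrow> 'u) \<Rightarrow> ('v \<Rightarrow> 'v \<Rightarrow> 'u) \<Rightarrow> bool"
  where
  "alternating_bilinear sV sU f \<longleftrightarrow>
     (\<forall>x. Vector_Spaces.linear sV sU (f x)) \<and>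
     (\<forall>y. Vector_Spaces.linear sV sU (\<lambda>x. f x y)) \<and>
     (\<forall>x. f x x = 0)"

text \<open>
  The universal property of \<open>\<And>\<^sup>2 V\<close>. A locale cannot quantify over the type of the target, so it is
  imposed for scalar-valued forms only; the lemma \<open>universal_property\<close> below derives it for
  arbitrary target spaces.
\<close>

locale exterior_square = V: vector_space sV + W: vector_space sW
  for sV :: "'k::field \<Rightarrow> 'v::ab_group_add \<Rightarrow> 'v"
    and sW :: "'k \<Rightarrow> 'w::ab_group_add \<Rightarrow> 'w" +
  fixes wedge :: "'v \<Rightarrow> 'v \<Rightarrow> 'w"
  assumes alternating_wedge: "alternating_bilinear sV sW wedge"
    and universal: "\<And>f :: 'v \<Rightarrow> 'v \<Rightarrow> 'k. alternating_bilinear sV (*) f \<Longrightarrow>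
      \<exists>!g. Vector_Spaces.linear sW (*) g \<and> (\<forall>x y. g (wedge x y) = f x y)"
begin

lemma vector_space_scalars: "vector_space ((*) :: 'k \<Rightarrow> 'k \<Rightarrow> 'k)"
  by unfold_locales (auto simp: algebra_simps)

lemma span_wedge: "W.span {wedge x y |x y. True} = UNIV"
proof (rule ccontr)
  let ?S = "{wedge x y |x y. True}"
  interpret K: vector_space "(*) :: 'k \<Rightarrow> 'k \<Rightarrow> 'k" by (rule vector_space_scalars)
  interpret WK: vector_space_pair sW "(*) :: 'k \<Rightarrow> 'k \<Rightarrow> 'k" by unfold_locales
  interpret VK: vector_space_pair sV "(*) :: 'k \<Rightarrow> 'k \<Rightarrow> 'k" by unfold_locales
  assume "W.span ?S \<noteq> UNIV"
  then obtain z where z: "z \<notin> W.span ?S" by auto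
  obtain B where B: "B \<subseteq> ?S" "W.independent B" "?S \<subseteq> W.span B"
    using W.maximal_independent_subset by blast
  have "W.span B = W.span ?S"
    using B W.span_mono W.span_minimal by (metis W.subspace_span subset_antisym)
  with z have zB: "z \<notin> W.span B" by simp
  hence ind: "W.independent (insert z B)"
    using B(2) by (simp add: W.independent_insert)
  from WK.linear_independent_extend[OF ind, of "\<lambda>b. if b = z then 1 else 0"]
  obtain g where g: "Vector_Spaces.linear sW (*) g"
    and gb: "\<forall>b\<in>insert z B. g b = (if b = z then 1 else 0)" by blast
  have gB: "g b = 0" if "b \<in> B" for b
    using gb that zB W.span_base by fastforce
  have "g w = 0" if "w \<in> W.span B" for w
    by (rule WK.linear_eq_0_on_span[OF g gB that])
  hence "\<forall>x y. g (wedge x y) = 0" using B(3) by blast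
  moreover have "Vector_Spaces.linear sW (*) (\<lambda>_. 0 :: 'k)" by (rule WK.linear_zero)
  moreover have "alternating_bilinear sV (*) (\<lambda>_ _. 0 :: 'k)"
    by (simp add: alternating_bilinear_def VK.linear_zero)
  ultimately have "g = (\<lambda>_. 0)" using universal g by blast
  thus False using gb by simp
qed

lemma universal_property:
  fixes sU :: "'k \<Rightarrow> 'u::ab_group_add \<Rightarrow> 'u"
  assumes "vector_space sU" and f: "alternating_bilinear sV sU f"
  shows "\<exists>!g. Vector_Spaces.linear sW sU g \<and> (\<forall>x y. g (wedge x y) = f x y)"
proof -
  let ?S = "{wedge x y |x y. True}"
  interpret K: vector_space "(*) :: 'k \<Rightarrow> 'k \<Rightarrow> 'k" by (rule vector_space_scalars)
  interpret U: vector_space sU by fact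
  interpret WK: vector_space_pair sW "(*) :: 'k \<Rightarrow> 'k \<Rightarrow> 'k" by unfold_locales
  interpret UK: vector_space_pair sU "(*) :: 'k \<Rightarrow> 'k \<Rightarrow> 'k" by unfold_locales
  interpret WU: vector_space_pair sW sU by unfold_locales
  obtain B where B: "B \<subseteq> ?S" "W.independent B" "?S \<subseteq> W.span B"
    using W.maximal_independent_subset by blast
  have spanB: "W.span B = UNIV"
    using B span_wedge W.span_minimal by (metis W.subspace_span top.extremum_unique)
  define h where "h b = (SOME u. \<exists>x y. b = wedge x y \<and> u = f x y)" for b
  have h: "\<exists>x y. b = wedge x y \<and> h b = f x y" if "b \<in> B" for b
    unfolding h_def using B(1) that by (intro someI_ex[of "\<lambda>u. \<exists>x y. b = wedge x y \<and> u = f x y"]) blast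
  obtain g where g: "Vector_Spaces.linear sW sU g" and gB: "\<forall>b\<in>B. g b = h b"
    using WU.linear_independent_extend[OF B(2)] by blast
  have "g (wedge x y) = f x y" for x y
  proof (rule ccontr)
    assume neq: "g (wedge x y) \<noteq> f x y"
    define u where "u = g (wedge x y) - f x y"
    have "u \<noteq> 0" using neq by (simp add: u_def)
    hence "U.independent {u}" by simp
    from UK.linear_independent_extend[OF this, of "\<lambda>_. 1"]
    obtain l where l: "Vector_Spaces.linear sU (*) l" and lu: "l u = 1" by auto
    have "alternating_bilinear sV (*) (\<lambda>x y. l (f x y))"
    proof -
      have "Vector_Spaces.linear sV (*) (l \<circ> f x)" "Vector_Spaces.linear sV (*) (l \<circ> (\<lambda>x. f x y))"
        for x y
        using f l by (auto simp: alternating_bilinear_def intro!: Vector_Spaces.linear_compose)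
      moreover have "l 0 = 0" using UK.linear_0[OF l] .
      ultimately show ?thesis using f by (simp add: alternating_bilinear_def o_def)
    qed
    then obtain gl where gl: "Vector_Spaces.linear sW (*) gl"
      and gl_wedge: "\<And>x y. gl (wedge x y) = l (f x y)"
      using universal by blast
    have lg: "Vector_Spaces.linear sW (*) (l \<circ> g)"
      using g l by (rule Vector_Spaces.linear_compose)
    have "gl b = (l \<circ> g) b" if "b \<in> B" for b
      using h[OF that] gB that gl_wedge by auto
    hence "gl w = (l \<circ> g) w" for w
      using WK.linear_eq_on[OF gl lg] spanB by blast
    hence "l (g (wedge x y)) = l (f x y)" using gl_wedge by (metis comp_apply)
    hence "l u = 0" using UK.linear_diff[OF l] by (simp add: u_def)
    thus False using lu by simp
  qed
  moreover have "g1 = g2"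
    if "Vector_Spaces.linear sW sU g1" "\<forall>x y. g1 (wedge x y) = f x y"
      "Vector_Spaces.linear sW sU g2" "\<forall>x y. g2 (wedge x y) = f x y" for g1 g2
  proof
    fix w
    have "w \<in> W.span ?S" using span_wedge by simp
    thus "g1 w = g2 w"
      by (rule WU.linear_eq_on[OF that(1,3)]) (use that(2,4) in auto)
  qed
  ultimately show ?thesis using g by blast
qed

end


section \<open>Grassmannians and their tangent spaces\<close>

definition Gr :: "('k::field \<Rightarrow> 'u::ab_group_add \<Rightarrow> 'u) \<Rightarrow> nat \<Rightarrow> 'u set set" where
  "Gr s k = {L. Modules.module.subspace s L \<and> vector_space.dim s L = k}"

text \<open>
  The tangent space of a Grassmannian at \<open>L\<close> is the set of its \<open>K[\<epsilon>]\<close>-valued points above \<open>L\<close>, that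
  is, of the direct summands of the \<open>K[\<epsilon>]\<close>-module \<open>U \<otimes> K[\<epsilon>]\<close> whose reduction modulo \<open>\<epsilon>\<close> is \<open>L\<close>.
  The lemma \<open>tangent_Gr_iff\<close> identifies these with the linear maps from \<open>L\<close> to \<open>U / L\<close>.
\<close>

definition tangent_Gr ::
  "('k::field \<Rightarrow> 'u::ab_group_add \<Rightarrow> 'u) \<Rightarrow> 'u set \<Rightarrow> ('u \<times> 'u) set set" where
  "tangent_Gr s L = {M.
     Modules.module.subspace (dual_scale s) M \<and>
     (\<exists>N. Modules.module.subspace (dual_scale s) N \<and> M \<inter> N = {0} \<and>
          {m + n |m n. m \<in> M \<and> n \<in> N} = UNIV) \<and>
     fst ` M = L}"


lemma tangent_Gr_iff:
  fixes s :: "'k::field \<Rightarrow> 'u::ab_group_add \<Rightarrow> 'u"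
  assumes "vector_space s" and L: "Modules.module.subspace s L"
  shows "M \<in> tangent_Gr s L \<longleftrightarrow>
    (\<exists>\<phi>. Vector_Spaces.linear s s \<phi> \<and> M = {(x, y). x \<in> L \<and> y - \<phi> x \<in> L})"
proof -
  interpret U: vector_space s by fact
  interpret UU: vector_space_pair s s by unfold_locales
  interpret D: Modules.module "dual_scale s"
    by (rule module_dual_scale) unfold_locales
  note simps = dual_scale_def zero_prod_def plus_prod_def
  show ?thesis
  proof
    assume "M \<in> tangent_Gr s L"
    then obtain N where M: "D.subspace M" and N: "D.subspace N" and MN: "M \<inter> N = {0}"
      and sum: "{m + n |m n. m \<in> M \<and> n \<in> N} = UNIV" and fstM: "fst ` M = L"
      by (auto simp: tangent_Gr_def)
    have epsM: "(0, x) \<in> M" if "(x, y) \<in> M" for x y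
      using D.subspace_scale[OF M that, of "Dual 0 1"] by (simp add: simps)
    have zero: "(0, w) \<in> M \<longleftrightarrow> w \<in> L" for w
    proof
      assume w: "(0, w) \<in> M"
      have "(w, 0) \<in> {m + n |m n. m \<in> M \<and> n \<in> N}" using sum by blast
      then obtain m n where mn: "(w, 0) = m + n" "m \<in> M" "n \<in> N" by blast
      have m: "(0, fst m) \<in> M" using epsM[of "fst m" "snd m"] mn(2) by simp
      have n: "(0, fst n) \<in> N"
        using D.subspace_scale[OF N mn(3), of "Dual 0 1"] by (simp add: simps)
      have w_eq: "w = fst m + fst n" using arg_cong[OF mn(1), of fst] by simp
      have "(0, w) - (0, fst m) \<in> M" by (rule D.subspace_diff[OF M w m])
      hence "(0, fst n) \<in> M" by (simp add: w_eq)
      hence "(0, fst n) \<in> M \<inter> N" using n by (rule IntI)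
      hence "(0, fst n) = (0 :: 'u \<times> 'u)" unfolding MN by (rule singletonD)
      hence "w = fst m" by (simp add: w_eq zero_prod_def)
      thus "w \<in> L" using fstM mn(2) by blast
    next
      assume "w \<in> L"
      thus "(0, w) \<in> M" using fstM epsM by force
    qed
    obtain B where B: "B \<subseteq> L" "U.independent B" "L \<subseteq> U.span B"
      using U.maximal_independent_subset by blast
    have "\<forall>b\<in>B. \<exists>y. (b, y) \<in> M" using B(1) fstM by force
    then obtain h where h: "\<And>b. b \<in> B \<Longrightarrow> (b, h b) \<in> M" by metis
    obtain \<phi> where \<phi>: "Vector_Spaces.linear s s \<phi>" and \<phi>B: "\<forall>b\<in>B. \<phi> b = h b"
      using UU.linear_independent_extend[OF B(2)] by blast
    have "U.subspace {x. (x, \<phi> x) \<in> M}"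
    proof (rule U.subspaceI)
      show "0 \<in> {x. (x, \<phi> x) \<in> M}"
        using D.subspace_0[OF M] UU.linear_0[OF \<phi>] by (simp add: simps)
      show "x + y \<in> {x. (x, \<phi> x) \<in> M}"
        if "x \<in> {x. (x, \<phi> x) \<in> M}" "y \<in> {x. (x, \<phi> x) \<in> M}" for x y
        using D.subspace_add[OF M, of "(x, \<phi> x)" "(y, \<phi> y)"] that UU.linear_add[OF \<phi>]
        by (simp add: simps)
      show "s c x \<in> {x. (x, \<phi> x) \<in> M}" if "x \<in> {x. (x, \<phi> x) \<in> M}" for c x
        using D.subspace_scale[OF M, of "(x, \<phi> x)" "Dual c 0"] that UU.linear_scale[OF \<phi>]
        by (simp add: simps)
    qed
    moreover have "B \<subseteq> {x. (x, \<phi> x) \<in> M}" using h \<phi>B by auto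
    ultimately have graph: "(x, \<phi> x) \<in> M" if "x \<in> L" for x
      using U.span_minimal B(3) that by blast
    have "(x, y) \<in> M \<longleftrightarrow> x \<in> L \<and> y - \<phi> x \<in> L" for x y
    proof
      assume xy: "(x, y) \<in> M"
      hence x: "x \<in> L" using fstM by force
      have "(0, y - \<phi> x) \<in> M" using D.subspace_diff[OF M xy graph[OF x]] by simp
      thus "x \<in> L \<and> y - \<phi> x \<in> L" using x zero by blast
    next
      assume xy: "x \<in> L \<and> y - \<phi> x \<in> L"
      hence "(0, y - \<phi> x) \<in> M" using zero by blast
      thus "(x, y) \<in> M"
        using D.subspace_add[OF M graph[of x]] xy by force
    qed
    hence "M = {(x, y). x \<in> L \<and> y - \<phi> x \<in> L}" by auto
    thus "\<exists>\<phi>. Vector_Spaces.linear s s \<phi> \<and> M = {(x, y). x \<in> L \<and> y - \<phi> x \<in> L}"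
      using \<phi> by blast
  next
    assume "\<exists>\<phi>. Vector_Spaces.linear s s \<phi> \<and> M = {(x, y). x \<in> L \<and> y - \<phi> x \<in> L}"
    then obtain \<phi> where \<phi>: "Vector_Spaces.linear s s \<phi>"
      and M: "M = {(x, y). x \<in> L \<and> y - \<phi> x \<in> L}" by blast
    have idl: "Vector_Spaces.linear s s (\<lambda>x. x)" by (rule U.linear_ident)
    obtain \<pi> where \<pi>: "range \<pi> \<subseteq> L" "Vector_Spaces.linear s s \<pi>" "\<forall>v\<in>L. \<pi> v = v"
      using UU.linear_exists_left_inverse_on[OF idl L] by (auto simp: inj_on_def)
    define N where "N = {(x, y). \<pi> x = 0 \<and> \<pi> y = 0}"
    note lin = UU.linear_0[OF \<phi>] UU.linear_add[OF \<phi>] UU.linear_scale[OF \<phi>] UU.linear_diff[OF \<phi>]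
      UU.linear_0[OF \<pi>(2)] UU.linear_add[OF \<pi>(2)] UU.linear_scale[OF \<pi>(2)]
      UU.linear_diff[OF \<pi>(2)]
    note sub = U.subspace_0[OF L] U.subspace_add[OF L] U.subspace_scale[OF L]
      U.subspace_diff[OF L]
    have "D.subspace M"
    proof (rule D.subspaceI)
      show "0 \<in> M" using sub by (simp add: M simps lin)
      show "u + v \<in> M" if "u \<in> M" "v \<in> M" for u v
      proof -
        have eq: "snd u + snd v - \<phi> (fst u + fst v) = (snd u - \<phi> (fst u)) + (snd v - \<phi> (fst v))"
          by (simp add: lin)
        have "snd u + snd v - \<phi> (fst u + fst v) \<in> L"
          unfolding eq using that by (intro sub(2)) (auto simp: M)
        moreover have "fst u + fst v \<in> L" using that by (intro sub(2)) (auto simp: M)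
        ultimately show ?thesis by (simp add: M plus_prod_def)
      qed
      show "dual_scale s c u \<in> M" if "u \<in> M" for c u
      proof -
        have eq: "s (std c) (snd u) + s (inf c) (fst u) - \<phi> (s (std c) (fst u)) =
            s (std c) (snd u - \<phi> (fst u)) + s (inf c) (fst u)"
          by (simp add: lin U.scale_right_diff_distrib)
        have "s (std c) (snd u) + s (inf c) (fst u) - \<phi> (s (std c) (fst u)) \<in> L"
          unfolding eq using that by (intro sub(2,3)) (auto simp: M)
        moreover have "s (std c) (fst u) \<in> L" using that by (intro sub(3)) (auto simp: M)
        ultimately show ?thesis by (simp add: M dual_scale_def)
      qed
    qed
    moreover have "D.subspace N"
      by (rule D.subspaceI) (auto simp: N_def simps lin)
    moreover have "M \<inter> N = {0}"
    proof -
      have "x = 0 \<and> y = 0" if h: "x \<in> L" "y - \<phi> x \<in> L" "\<pi> x = 0" "\<pi> y = 0" for x y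
      proof -
        have x: "x = 0" using h(1,3) \<pi>(3) by simp
        hence "y \<in> L" using h(2) by (simp add: lin)
        thus ?thesis using x h(4) \<pi>(3) by simp
      qed
      thus ?thesis using sub by (auto simp: M N_def zero_prod_def lin)
    qed
    moreover have "\<exists>m n. (a, b) = m + n \<and> m \<in> M \<and> n \<in> N" for a b
    proof (intro exI conjI)
      show "(a, b) = (\<pi> a, \<phi> (\<pi> a) + \<pi> (b - \<phi> (\<pi> a))) +
          (a - \<pi> a, (b - \<phi> (\<pi> a)) - \<pi> (b - \<phi> (\<pi> a)))"
        by (simp add: plus_prod_def)
      have \<pi>L: "\<pi> z \<in> L" for z using \<pi>(1) by blast
      have \<pi>0: "\<pi> (z - \<pi> z) = 0" for z using \<pi>(3) \<pi>L[of z] by (simp add: lin(8))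
      show "(\<pi> a, \<phi> (\<pi> a) + \<pi> (b - \<phi> (\<pi> a))) \<in> M"
        "(a - \<pi> a, (b - \<phi> (\<pi> a)) - \<pi> (b - \<phi> (\<pi> a))) \<in> N"
        using \<pi>L \<pi>0 by (simp_all only: M N_def mem_Collect_eq prod.case add_diff_cancel_left' simp_thms)
    qed
    hence "{m + n |m n. m \<in> M \<and> n \<in> N} = UNIV" by auto
    moreover have "fst ` M = L"
    proof -
      have "x \<in> fst ` M" if "x \<in> L" for x
        using that sub(1) by (intro image_eqI[of _ _ "(x, \<phi> x)"]) (simp_all add: M)
      moreover have "fst ` M \<subseteq> L" by (auto simp: M)
      ultimately show ?thesis by blast
    qed
    ultimately show "M \<in> tangent_Gr s L" unfolding tangent_Gr_def by blast
  qed
qed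


section \<open>The Zariski topology on a product of Grassmannians of planes\<close>

text \<open>The line \<open>\<And>\<^sup>2 L\<close> for a plane \<open>L\<close>; the scalars may be \<open>K\<close> or \<open>K[\<epsilon>]\<close>.\<close>

definition ext2 ::
  "('a::comm_ring_1 \<Rightarrow> 'w::ab_group_add \<Rightarrow> 'w) \<Rightarrow> ('v \<Rightarrow> 'v \<Rightarrow> 'w) \<Rightarrow> 'v set \<Rightarrow> 'w set" where
  "ext2 sW wedge L = Modules.module.span sW {wedge x y |x y. x \<in> L \<and> y \<in> L}"

inductive_set poly_funs ::
  "('k::field \<Rightarrow> 'w::ab_group_add \<Rightarrow> 'w) \<Rightarrow> nat \<Rightarrow> ((nat \<Rightarrow> 'w) \<Rightarrow> 'k) set"
  for s :: "'k \<Rightarrow> 'w \<Rightarrow> 'w" and r :: nat where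
  const: "(\<lambda>_. c) \<in> poly_funs s r"
| coord: "i < r \<Longrightarrow> Vector_Spaces.linear s (*) l \<Longrightarrow> (\<lambda>w. l (w i)) \<in> poly_funs s r"
| add: "F \<in> poly_funs s r \<Longrightarrow> G \<in> poly_funs s r \<Longrightarrow> (\<lambda>w. F w + G w) \<in> poly_funs s r"
| mult: "F \<in> poly_funs s r \<Longrightarrow> G \<in> poly_funs s r \<Longrightarrow> (\<lambda>w. F w * G w) \<in> poly_funs s r"

definition multihomogeneous ::
  "('k::field \<Rightarrow> 'w \<Rightarrow> 'w) \<Rightarrow> nat \<Rightarrow> ((nat \<Rightarrow> 'w) \<Rightarrow> 'k) \<Rightarrow> bool" where
  "multihomogeneous s r F \<longleftrightarrow>
     (\<exists>n :: nat \<Rightarrow> nat. \<forall>c w. F (\<lambda>i. s (c i) (w i)) = (\<Prod>i<r. c i ^ n i) * F w)"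

abbreviation Gr2_power ::
  "('k::field \<Rightarrow> 'v::ab_group_add \<Rightarrow> 'v) \<Rightarrow> nat \<Rightarrow> (nat \<Rightarrow> 'v set) set" where
  "Gr2_power sV r \<equiv> {..<r} \<rightarrow>\<^sub>E Gr sV 2"

text \<open>
  The Zariski topology on \<open>Gr(2,V)\<^sup>r\<close> is induced by the Pluecker embedding into \<open>P(\<And>\<^sup>2 V)\<^sup>r\<close>: it is
  generated by the non-vanishing sets of multihomogeneous polynomials in the Pluecker vectors.
\<close>

definition zariski_Gr2_power ::
  "('k::field \<Rightarrow> 'v::ab_group_add \<Rightarrow> 'v) \<Rightarrow> ('k \<Rightarrow> 'w::ab_group_add \<Rightarrow> 'w) \<Rightarrow>
   ('v \<Rightarrow> 'v \<Rightarrow> 'w) \<Rightarrow> nat \<Rightarrow> (nat \<Rightarrow> 'v set) topology" where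
  "zariski_Gr2_power sV sW wedge r = topology_generated_by
     {{L \<in> Gr2_power sV r. \<forall>w. (\<forall>i<r. w i \<in> ext2 sW wedge (L i) - {0}) \<longrightarrow> F w \<noteq> 0} |F.
        F \<in> poly_funs sW r \<and> multihomogeneous sW r F}"


section \<open>The decomposability map\<close>

text \<open>The scalars may be \<open>K\<close> or \<open>K[\<epsilon>]\<close>, giving the map on \<open>K\<close>-points and on \<open>K[\<epsilon>]\<close>-points.\<close>

definition Psi ::
  "('a::comm_ring_1 \<Rightarrow> 'w::ab_group_add \<Rightarrow> 'w) \<Rightarrow> ('v \<Rightarrow> 'v \<Rightarrow> 'w) \<Rightarrow> nat \<Rightarrow>
   (nat \<Rightarrow> 'v set) \<Rightarrow> 'w set" where
  "Psi sW wedge r L = Modules.module.span sW (\<Union>i<r. ext2 sW wedge (L i))"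

definition Psi_domain ::
  "('k::field \<Rightarrow> 'v::ab_group_add \<Rightarrow> 'v) \<Rightarrow> ('k \<Rightarrow> 'w::ab_group_add \<Rightarrow> 'w) \<Rightarrow>
   ('v \<Rightarrow> 'v \<Rightarrow> 'w) \<Rightarrow> nat \<Rightarrow> (nat \<Rightarrow> 'v set) set" where
  "Psi_domain sV sW wedge r = {L \<in> Gr2_power sV r.
     \<forall>w. (\<forall>i<r. w i \<in> ext2 sW wedge (L i)) \<longrightarrow> (\<Sum>i<r. w i) = 0 \<longrightarrow> (\<forall>i<r. w i = 0)}"

text \<open>
  The differential at \<open>L\<close> is the restriction of the map on \<open>K[\<epsilon>]\<close>-points to the tangent space at \<open>L\<close>.
\<close>

definition Psi_submersion_at ::
  "('k::field \<Rightarrow> 'v::ab_group_add \<Rightarrow> 'v) \<Rightarrow> ('k \<Rightarrow> 'w::ab_group_add \<Rightarrow> 'w) \<Rightarrow>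
   ('v \<Rightarrow> 'v \<Rightarrow> 'w) \<Rightarrow> nat \<Rightarrow> (nat \<Rightarrow> 'v set) \<Rightarrow> bool" where
  "Psi_submersion_at sV sW wedge r L \<longleftrightarrow>
     Psi (dual_scale sW) (dual_wedge wedge) r ` (\<Pi>\<^sub>E i\<in>{..<r}. tangent_Gr sV (L i)) =
     tangent_Gr sW (Psi sW wedge r L)"

end

theory Submission
  imports Defs "Jordan_Normal_Form.Determinant"
begin

text \<open>
  Let \<open>L\<^sub>i\<close> be spanned by \<open>x\<^sub>i, y\<^sub>i\<close>, let \<open>\<omega>\<^sub>i = x\<^sub>i \<and> y\<^sub>i\<close> and let \<open>\<Lambda>\<close> be the span of the \<open>\<omega>\<^sub>i\<close>. By the
  Leibniz rule the differential of \<open>\<Psi>\<close> sends \<open>(\<phi>\<^sub>i : L\<^sub>i \<rightarrow> V / L\<^sub>i)\<^sub>i\<close> to the map \<open>\<Lambda> \<rightarrow> W / \<Lambda>\<close> with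
  \<open>\<omega>\<^sub>i \<mapsto> \<phi>\<^sub>i x\<^sub>i \<and> y\<^sub>i + x\<^sub>i \<and> \<phi>\<^sub>i y\<^sub>i\<close>. Its image is therefore the product over \<open>i\<close> of the spaces
  \<open>(V \<and> L\<^sub>i + \<Lambda>) / \<Lambda>\<close>, and \<open>\<Psi>\<close> is a submersion at the point if and only if \<open>V \<and> L\<^sub>i + \<Lambda> = W\<close> for every
  \<open>i\<close> (\<open>submersion_iff\<close>).

  The quotient of \<open>W\<close> by \<open>V \<and> L\<^sub>i\<close> is the exterior square of \<open>V / L\<^sub>i\<close>, of dimension \<open>d - 2 choose 2\<close>, and
  \<open>\<omega>\<^sub>i\<close> vanishes in it. The other \<open>r - 1\<close> bivectors have to span it, which gives
  \<open>r - 1 \<ge> (d - 2 choose 2)\<close> (\<open>submersion_bound\<close>). Conversely, if this inequality holds, then for each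
  fixed \<open>i\<close> there is a configuration of planes with this spanning property
  (\<open>spanning_configuration\<close>).

  The spanning property is the nonvanishing of suitable minors, which are multihomogeneous
  polynomials in the \<open>\<omega>\<^sub>j\<close>, because \<open>V \<and> L\<^sub>i\<close> is spanned by linear images of \<open>\<omega>\<^sub>i\<close>: wedge an arbitrary
  vector with a contraction of \<open>\<omega>\<^sub>i\<close> (\<open>spanning_polynomial\<close>). So the set of submersion points is open. It
  is dense because finitely many polynomials, each of them nonzero at some frame \<open>(x, y)\<close>, are
  simultaneously nonzero at some frame, as one sees by restricting to lines in the space of frames
  over an infinite field (\<open>bivectors_irreducible_finite\<close>).
\<close>

section \<open>The scalars\<close>

text \<open>
  The natural numbers already give infinitely many scalars: modulo \<open>p ^ k\<close> with \<open>k\<close> large, distinct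
  naturals stay distinct. Over an infinite field a nonzero polynomial in one variable has a
  non-zero, which is what the density argument rests on.
\<close>

lemma infinite_padic: "infinite (UNIV :: 'p::prime_card padic set)"
proof -
  have gt1: "CARD('p) > Suc 0"
    using prime_gt_1_nat[OF prime_card[where ?'a = 'p]] by simp
  have lim: "int n < int CARD('p) ^ n" for n
    unfolding of_nat_power[symmetric] of_nat_less_iff by (rule power_gt_expt[OF gt1])
  have Rep: "Rep_padic_int (of_nat n :: 'p padic_int) k = int n mod int CARD('p) ^ k" for n k
  proof (induction n)
    case 0
    show ?case by (simp add: zero_padic_int.rep_eq)
  next
    case (Suc n)
    show ?case
      by (simp only: of_nat_Suc plus_padic_int.rep_eq one_padic_int.rep_eq Suc mod_add_eq)
  qed
  have "inj (of_nat :: nat \<Rightarrow> 'p padic_int)"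
  proof (rule injI)
    fix m n :: nat
    assume eq: "(of_nat m :: 'p padic_int) = of_nat n"
    \<comment> \<open>Both numbers are below \<open>p ^ ?k\<close>, hence equal to their residues at level \<open>?k\<close>.\<close>
    let ?k = "max m n"
    have "int CARD('p) ^ m \<le> int CARD('p) ^ ?k" "int CARD('p) ^ n \<le> int CARD('p) ^ ?k"
      using gt1 by (auto intro!: power_increasing)
    hence "int m < int CARD('p) ^ ?k" "int n < int CARD('p) ^ ?k"
      using lim[of m] lim[of n] by linarith+
    thus "m = n"
      using Rep[of m ?k] Rep[of n ?k] unfolding eq by simp
  qed
  moreover have "inj (to_fract :: 'p padic_int \<Rightarrow> 'p padic)"
    by (rule injI) simp
  ultimately have "inj ((to_fract :: 'p padic_int \<Rightarrow> 'p padic) \<circ> of_nat)"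
    by (rule inj_compose[rotated])
  hence "infinite (range ((to_fract :: 'p padic_int \<Rightarrow> 'p padic) \<circ> of_nat))"
    by (rule range_inj_infinite)
  thus ?thesis by (rule infinite_super[OF subset_UNIV])
qed

section \<open>Independent families\<close>

text \<open>
  Independence is phrased for families rather than sets because the bivectors of a tuple of planes
  are indexed, and the condition defining the domain of \<open>\<Psi>\<close> is a condition on such a family:
  repetitions make it fail.
\<close>

definition independent_family :: "('k::field \<Rightarrow> 'u::ab_group_add \<Rightarrow> 'u) \<Rightarrow> ('i \<Rightarrow> 'u) \<Rightarrow> 'i set \<Rightarrow> bool"
  where
  "independent_family s u I \<longleftrightarrow> (\<forall>a. (\<Sum>i\<in>I. s (a i) (u i)) = 0 \<longrightarrow> (\<forall>i\<in>I. a i = 0))"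

lemma vector_space_field: "vector_space ((*) :: 'k::field \<Rightarrow> 'k \<Rightarrow> 'k)"
  by unfold_locales (auto simp: algebra_simps)

lemma independent_family_iff:
  fixes s :: "'k::field \<Rightarrow> 'u::ab_group_add \<Rightarrow> 'u"
  assumes "vector_space s" and "finite I"
  shows "independent_family s u I \<longleftrightarrow> inj_on u I \<and> \<not> Modules.module.dependent s (u ` I)"
proof -
  interpret S: vector_space s by fact
  show ?thesis
  proof
    assume ind: "independent_family s u I"
    hence zero: "\<And>a i. (\<Sum>i\<in>I. s (a i) (u i)) = 0 \<Longrightarrow> i \<in> I \<Longrightarrow> a i = 0"
      unfolding independent_family_def by blast
    have inj: "inj_on u I"
    proof (rule inj_onI, rule ccontr)
      fix i j assume ij: "i \<in> I" "j \<in> I" "u i = u j" "i \<noteq> j"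
      let ?a = "\<lambda>k. if k = i then 1 else if k = j then -1 else 0 :: 'k"
      have "(\<Sum>k\<in>I. s (?a k) (u k)) = (\<Sum>k\<in>{i,j}. s (?a k) (u k))"
        using ij assms by (intro sum.mono_neutral_right) auto
      also have "\<dots> = 0" using ij by simp
      finally have "?a i = 0" by (rule zero[of ?a, OF _ ij(1)])
      thus False by simp
    qed
    moreover have "S.independent (u ` I)"
    proof (rule S.independent_if_scalars_zero)
      fix a v assume a: "(\<Sum>v\<in>u ` I. s (a v) v) = 0" and v: "v \<in> u ` I"
      have "(\<Sum>i\<in>I. s (a (u i)) (u i)) = 0"
        using a by (simp add: sum.reindex[OF inj])
      thus "a v = 0" using zero[of "\<lambda>i. a (u i)"] v by blast
    qed (use assms in simp)
    ultimately show "inj_on u I \<and> S.independent (u ` I)" by simp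
  next
    assume "inj_on u I \<and> S.independent (u ` I)"
    hence inj: "inj_on u I" and ind: "S.independent (u ` I)" by auto
    show "independent_family s u I"
      unfolding independent_family_def
    proof (intro allI impI)
      fix a assume a: "(\<Sum>i\<in>I. s (a i) (u i)) = 0"
      have "(\<Sum>v\<in>u ` I. s (a (the_inv_into I u v)) v) = (\<Sum>i\<in>I. s (a i) (u i))"
        by (subst sum.reindex[OF inj]) (simp add: the_inv_into_f_f[OF inj])
      hence "(\<Sum>v\<in>u ` I. s (a (the_inv_into I u v)) v) = 0" using a by simp
      hence "\<forall>v\<in>u ` I. a (the_inv_into I u v) = 0"
        using S.independent_explicit_finite_subsets[THEN iffD1, OF ind, rule_format, OF order_refl,
            of "\<lambda>v. a (the_inv_into I u v)"] assms(2) by blast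
      thus "\<forall>i\<in>I. a i = 0" by (simp add: the_inv_into_f_f[OF inj])
    qed
  qed
qed

lemma independent_family_extend:
  assumes "vector_space s" "vector_space t" "finite I" and "independent_family s u I"
  obtains g where "Vector_Spaces.linear s t g" and "\<And>i. i \<in> I \<Longrightarrow> g (u i) = h i"
proof -
  interpret ST: vector_space_pair s t using assms by (intro vector_space_pair.intro)
  have inj: "inj_on u I" and ind: "ST.vs1.independent (u ` I)"
    using assms by (auto simp: independent_family_iff)
  obtain g where "Vector_Spaces.linear s t g"
    and "\<forall>v\<in>u ` I. g v = h (the_inv_into I u v)"
    using ST.linear_independent_extend[OF ind, of "\<lambda>v. h (the_inv_into I u v)"] by blast
  thus ?thesis by (intro that) (auto simp: the_inv_into_f_f[OF inj])
qed

lemma independent_family_dual: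
  assumes "vector_space s" "finite I" and "independent_family s u I"
  obtains l where "\<And>i. Vector_Spaces.linear s (*) (l i)"
    and "\<And>i j. j \<in> I \<Longrightarrow> l i (u j) = (if i = j then 1 else 0)"
proof -
  have "\<exists>g. Vector_Spaces.linear s (*) g \<and> (\<forall>j\<in>I. g (u j) = (if i = j then 1 else 0))" for i
    by (rule independent_family_extend[OF assms(1) vector_space_field assms(2,3),
          of "\<lambda>j. if i = j then 1 else 0"]) blast
  then obtain l where "\<forall>i. Vector_Spaces.linear s (*) (l i) \<and>
      (\<forall>j\<in>I. l i (u j) = (if i = j then 1 else 0))"
    using choice[of "\<lambda>i g. Vector_Spaces.linear s (*) g \<and>
      (\<forall>j\<in>I. g (u j) = (if i = j then 1 else 0))"] by blast
  thus ?thesis using that[of l] by blast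
qed

lemma independent_familyI_dual:
  assumes "finite I" and lin: "\<And>i. i \<in> I \<Longrightarrow> Vector_Spaces.linear s (*) (l i)"
    and dual: "\<And>i j. i \<in> I \<Longrightarrow> j \<in> I \<Longrightarrow> l i (u j) = (if i = j then 1 else 0)"
  shows "independent_family s u I"
  unfolding independent_family_def
proof (intro allI impI ballI)
  fix a i assume sum: "(\<Sum>j\<in>I. s (a j) (u j)) = 0" and i: "i \<in> I"
  interpret l: Vector_Spaces.linear s "(*)" "l i" by (rule lin[OF i])
  have "0 = l i (\<Sum>j\<in>I. s (a j) (u j))" by (simp add: sum l.zero)
  also have "\<dots> = (\<Sum>j\<in>I. a j * l i (u j))" by (simp add: l.sum l.scale)
  also have "\<dots> = (\<Sum>j\<in>I. if i = j then a j else 0)"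
    by (rule sum.cong) (auto simp: dual i)
  also have "\<dots> = a i" using i assms(1) by simp
  finally show "a i = 0" by simp
qed

lemma spanning_contains_basis_family:
  assumes "vector_space s" and span: "Modules.module.span s (f ` A) = UNIV"
    and "finite T" "Modules.module.span s T = UNIV"
  obtains k where "\<And>c. c < vector_space.dim s UNIV \<Longrightarrow> k c \<in> A"
    and "independent_family s (\<lambda>c. f (k c)) {..<vector_space.dim s UNIV}"
proof -
  interpret S: vector_space s by fact
  obtain B where B: "B \<subseteq> f ` A" "S.independent B" "f ` A \<subseteq> S.span B"
    using S.maximal_independent_subset by blast
  have spanB: "S.span B = UNIV"
    using span B(3) by (metis S.span_minimal S.subspace_span top.extremum_unique)
  have finB: "finite B"
    using S.independent_span_bound[OF assms(3) B(2)] assms(4) by simp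
  have "card B = S.dim UNIV"
    using S.basis_card_eq_dim[of B UNIV] B spanB by simp
  then obtain b where b: "bij_betw b {..<S.dim UNIV} B"
    using ex_bij_betw_nat_finite[OF finB] by (metis atLeast0LessThan)
  have "\<exists>a\<in>A. f a = b c" if "c < S.dim UNIV" for c
    using b B(1) that by (fastforce simp: bij_betw_def)
  then obtain k where k: "\<And>c. c < S.dim UNIV \<Longrightarrow> k c \<in> A \<and> f (k c) = b c"
    by metis
  have "inj_on (\<lambda>c. f (k c)) {..<S.dim UNIV}"
    using b k by (auto simp: bij_betw_def inj_on_def)
  moreover have "(\<lambda>c. f (k c)) ` {..<S.dim UNIV} = B"
    using b k by (force simp: bij_betw_def)
  ultimately show ?thesis
    using k B(2) by (intro that[of k]) (auto simp: independent_family_iff[OF assms(1)])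
qed

lemma independent_family_spans:
  assumes "vector_space s" and "independent_family s u {..<vector_space.dim s UNIV}"
    and "finite T" "Modules.module.span s T = UNIV"
  shows "Modules.module.span s (u ` {..<vector_space.dim s UNIV}) = UNIV"
proof -
  interpret S: vector_space s by fact
  obtain B where B: "B \<subseteq> T" "S.independent B" "T \<subseteq> S.span B"
    using S.maximal_independent_subset by blast
  have spanB: "S.span B = UNIV"
    using assms(4) B(3) by (metis S.span_minimal S.subspace_span top.extremum_unique)
  have finB: "finite B" using B(1) assms(3) finite_subset by blast
  interpret F: finite_dimensional_vector_space s B
    by unfold_locales (use B spanB finB in auto)
  show ?thesis
    using F.card_eq_dim[of "u ` {..<S.dim UNIV}" UNIV] assms(2)
    by (auto simp: independent_family_iff[OF assms(1)] card_image)
qed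

section \<open>Polynomial functions\<close>

lemma poly_funs_sum:
  "(\<And>a. a \<in> A \<Longrightarrow> F a \<in> poly_funs s r) \<Longrightarrow> (\<lambda>w. \<Sum>a\<in>A. F a w) \<in> poly_funs s r"
  by (induction A rule: infinite_finite_induct) (simp_all add: poly_funs.const poly_funs.add)

lemma poly_funs_prod:
  "(\<And>a. a \<in> A \<Longrightarrow> F a \<in> poly_funs s r) \<Longrightarrow> (\<lambda>w. \<Prod>a\<in>A. F a w) \<in> poly_funs s r"
  by (induction A rule: infinite_finite_induct) (simp_all add: poly_funs.const poly_funs.mult)

lemma poly_funs_cong:
  assumes "F \<in> poly_funs s r" and "\<And>i. i < r \<Longrightarrow> w i = w' i"
  shows "F w = F w'"
  using assms(1) by induction (simp_all add: assms(2))

lemma multihomogeneous_const: "multihomogeneous s r (\<lambda>_. c)"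
  unfolding multihomogeneous_def by (rule exI[of _ "\<lambda>_. 0"]) simp

lemma multihomogeneous_mult:
  assumes "multihomogeneous s r F" "multihomogeneous s r G"
  shows "multihomogeneous s r (\<lambda>w. F w * G w)"
proof -
  obtain m n where
    "\<forall>c w. F (\<lambda>i. s (c i) (w i)) = (\<Prod>i<r. c i ^ m i) * F w"
    "\<forall>c w. G (\<lambda>i. s (c i) (w i)) = (\<Prod>i<r. c i ^ n i) * G w"
    using assms unfolding multihomogeneous_def by blast
  thus ?thesis
    unfolding multihomogeneous_def
    by (intro exI[of _ "\<lambda>i. m i + n i"]) (simp add: power_add prod.distrib)
qed

lemma multihomogeneous_prod:
  "(\<And>a. a \<in> A \<Longrightarrow> multihomogeneous s r (F a)) \<Longrightarrow> multihomogeneous s r (\<lambda>w. \<Prod>a\<in>A. F a w)"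
  by (induction A rule: infinite_finite_induct)
    (simp_all add: multihomogeneous_mult multihomogeneous_const)

text \<open>
  Independence is an open condition with a multihomogeneous witness. At an independent family, choose
  functionals \<open>l b\<close> dual to it; the determinant of the matrix of values of the \<open>l b\<close> on the moving
  vectors \<open>T c (w (j c))\<close> is \<open>1\<close> at the given point, and where it does not vanish there is no linear
  relation between the columns. The Leibniz expansion shows that it is a polynomial in the \<open>w i\<close>,
  of degree in \<open>w i\<close> equal to the number of columns that depend on \<open>w i\<close>.
\<close>

lemma independence_minor:
  fixes s :: "'k::field \<Rightarrow> 'u::ab_group_add \<Rightarrow> 'u" and m :: nat
  assumes "vector_space s" and T: "\<And>c. c < m \<Longrightarrow> Vector_Spaces.linear s s (T c)"
    and j: "\<And>c. c < m \<Longrightarrow> j c < r"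
    and ind: "independent_family s (\<lambda>c. T c (w0 (j c))) {..<m}"
  obtains F where "F \<in> poly_funs s r" "multihomogeneous s r F" "F w0 \<noteq> 0"
    and "\<And>w. F w \<noteq> 0 \<Longrightarrow> independent_family s (\<lambda>c. T c (w (j c))) {..<m}"
proof -
  obtain l where l: "\<And>b. Vector_Spaces.linear s (*) (l b)"
    and dual: "\<And>b c. b < m \<Longrightarrow> c < m \<Longrightarrow> l b (T c (w0 (j c))) = (if b = c then 1 else 0)"
    using independent_family_dual[OF assms(1) finite_lessThan ind] by (metis lessThan_iff)
  interpret S: vector_space s by fact
  interpret BK: vector_space_pair s "(*)"
    using assms(1) vector_space_field by (rule vector_space_pair.intro)
  interpret BB: vector_space_pair s s
    using assms(1) by (rule vector_space_pair.intro) fact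
  define A where "A w = mat m m (\<lambda>(b, c). l b (T c (w (j c))))" for w
  have carr: "A w \<in> carrier_mat m m" for w by (simp add: A_def)
  have permutes_less: "p b < m" if "p permutes {0..<m}" "b < m" for p b
    using permutes_in_image[OF that(1), of b] that(2) by simp
  have leibniz: "det (A w) = (\<Sum>p | p permutes {0..<m}. signof p *
      (\<Prod>b = 0..<m. l b (T (p b) (w (j (p b))))))" for w
    unfolding det_def'[OF carr]
    by (rule sum.cong) (auto simp: A_def permutes_less intro!: prod.cong)
  show ?thesis
  proof (rule that)
    show "(\<lambda>w. det (A w)) \<in> poly_funs s r"
      unfolding leibniz
    proof (intro poly_funs_sum poly_funs.mult[OF poly_funs.const] poly_funs_prod)
      fix p b assume "p \<in> {p. p permutes {0..<m}}" "b \<in> {0..<m}"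
      hence "p b < m" by (simp add: permutes_less)
      have "Vector_Spaces.linear s (*) (l b \<circ> T (p b))"
        using T[OF \<open>p b < m\<close>] l by (rule Vector_Spaces.linear_compose)
      from poly_funs.coord[OF j[OF \<open>p b < m\<close>] this]
      show "(\<lambda>w. l b (T (p b) (w (j (p b))))) \<in> poly_funs s r" by simp
    qed
    show "multihomogeneous s r (\<lambda>w. det (A w))"
      unfolding multihomogeneous_def
    proof (intro exI[of _ "\<lambda>i. card {c \<in> {0..<m}. j c = i}"] allI)
      fix c :: "nat \<Rightarrow> 'k" and w
      have pw: "(\<Prod>i<r. c i ^ card {b \<in> {0..<m}. j b = i}) = (\<Prod>b = 0..<m. c (j b))"
      proof -
        have "(\<Prod>b = 0..<m. c (j b)) =
            (\<Prod>i<r. \<Prod>b | b \<in> {0..<m} \<and> j b = i. c (j b))"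
          using j by (intro prod.group[symmetric]) auto
        also have "\<dots> = (\<Prod>i<r. c i ^ card {b \<in> {0..<m}. j b = i})"
          by (intro prod.cong) auto
        finally show ?thesis ..
      qed
      have scaled: "(\<Prod>b = 0..<m. l b (T (p b) (s (c (j (p b))) (w (j (p b)))))) =
          (\<Prod>b = 0..<m. c (j b)) * (\<Prod>b = 0..<m. l b (T (p b) (w (j (p b)))))"
        if p: "p permutes {0..<m}" for p
      proof -
        have "(\<Prod>b = 0..<m. l b (T (p b) (s (c (j (p b))) (w (j (p b)))))) =
          (\<Prod>b = 0..<m. c (j (p b))) * (\<Prod>b = 0..<m. l b (T (p b) (w (j (p b)))))"
          unfolding prod.distrib[symmetric]
          by (intro prod.cong)
            (auto simp: permutes_less p BB.linear_scale[OF T] BK.linear_scale[OF l])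
        also have "(\<Prod>b = 0..<m. c (j (p b))) = (\<Prod>b = 0..<m. c (j b))"
          using prod.permute[OF p, of "\<lambda>b. c (j b)"] by (simp add: o_def)
        finally show ?thesis .
      qed
      show "det (A (\<lambda>i. s (c i) (w i))) =
          (\<Prod>i<r. c i ^ card {b \<in> {0..<m}. j b = i}) * det (A w)"
        unfolding leibniz pw sum_distrib_left
        by (rule sum.cong[OF refl]) (simp only: mem_Collect_eq scaled mult.left_commute)
    qed
    have "A w0 = 1\<^sub>m m" by (rule eq_matI) (simp_all add: A_def dual)
    thus "det (A w0) \<noteq> 0" by simp
    fix w assume det: "det (A w) \<noteq> 0"
    show "independent_family s (\<lambda>c. T c (w (j c))) {..<m}"
      unfolding independent_family_def
    proof (intro allI impI)
      fix a assume sum: "(\<Sum>c<m. s (a c) (T c (w (j c)))) = 0"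
      have "A w *\<^sub>v vec m a = 0\<^sub>v m"
      proof (rule eq_vecI)
        fix b assume b: "b < dim_vec (0\<^sub>v m :: _ vec)"
        have "(A w *\<^sub>v vec m a) $ b = (\<Sum>c<m. l b (T c (w (j c))) * a c)"
          using b by (simp add: A_def scalar_prod_def atLeast0LessThan)
        also have "\<dots> = l b (\<Sum>c<m. s (a c) (T c (w (j c))))"
          by (simp add: BK.linear_sum[OF l] BK.linear_scale[OF l] mult.commute)
        also have "\<dots> = 0" by (simp add: sum BK.linear_0[OF l])
        finally show "(A w *\<^sub>v vec m a) $ b = 0\<^sub>v m $ b" using b by simp
      qed (simp add: A_def)
      hence "vec m a = 0\<^sub>v m"
        using det det_0_iff_vec_prod_zero_field[OF carr] by (metis vec_carrier)
      thus "\<forall>c\<in>{..<m}. a c = 0" by (metis index_vec index_zero_vec(1) lessThan_iff)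
    qed
  qed
qed

text \<open>
  Spanning is open as well: at a point where the columns span, select among them a basis, whose
  independence persists nearby and forces it to span.
\<close>

lemma spanning_minor:
  assumes "vector_space s" and A: "\<And>T j. (T, j) \<in> A \<Longrightarrow> Vector_Spaces.linear s s T \<and> j < r"
    and fin: "finite B" "Modules.module.span s B = UNIV"
    and span: "Modules.module.span s ((\<lambda>(T, j). T (w0 j)) ` A) = UNIV"
  obtains F where "F \<in> poly_funs s r" "multihomogeneous s r F" "F w0 \<noteq> 0"
    and "\<And>w. F w \<noteq> 0 \<Longrightarrow> Modules.module.span s ((\<lambda>(T, j). T (w j)) ` A) = UNIV"
proof -
  interpret S: vector_space s by fact
  let ?n = "vector_space.dim s UNIV"
  obtain k where k: "\<And>c. c < ?n \<Longrightarrow> k c \<in> A"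
    and ind: "independent_family s (\<lambda>c. (\<lambda>(T, j). T (w0 j)) (k c)) {..<?n}"
    using spanning_contains_basis_family[OF assms(1) span fin] by blast
  have Tj: "Vector_Spaces.linear s s (fst (k c))" "snd (k c) < r" if "c < ?n" for c
    using A[of "fst (k c)" "snd (k c)"] k[OF that] by auto
  have "independent_family s (\<lambda>c. fst (k c) (w0 (snd (k c)))) {..<?n}"
    using ind by (simp add: case_prod_beta)
  from independence_minor[OF assms(1), of ?n "\<lambda>c. fst (k c)" "\<lambda>c. snd (k c)", OF Tj this]
  obtain F where F: "F \<in> poly_funs s r" "multihomogeneous s r F" "F w0 \<noteq> 0"
    and F_ind: "\<And>w. F w \<noteq> 0 \<Longrightarrow> independent_family s (\<lambda>c. fst (k c) (w (snd (k c)))) {..<?n}"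
    by blast
  have "Modules.module.span s ((\<lambda>(T, j). T (w j)) ` A) = UNIV" if "F w \<noteq> 0" for w
  proof -
    have "(\<lambda>c. fst (k c) (w (snd (k c)))) ` {..<?n} \<subseteq> (\<lambda>(T, j). T (w j)) ` A"
      using k by (force simp: case_prod_beta)
    thus ?thesis
      using independent_family_spans[OF assms(1) F_ind[OF that] fin] S.span_mono by blast
  qed
  with F show ?thesis using that by blast
qed



section \<open>Bivectors\<close>

definition increasing_pairs :: "nat \<Rightarrow> (nat \<times> nat) set" where
  "increasing_pairs d = {(a, b). a < b \<and> b < d}"

text \<open>
  Sorting the pairs by their larger entry makes the count the sum \<open>0 + 1 + \<dots> + (d - 1)\<close>.
\<close>

lemma increasing_pairs_Sigma: "increasing_pairs d = (\<lambda>(b, a). (a, b)) ` (SIGMA b:{..<d}. {..<b})"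
  by (force simp: increasing_pairs_def)

lemma finite_increasing_pairs: "finite (increasing_pairs d)"
  by (simp add: increasing_pairs_Sigma)

lemma card_increasing_pairs: "card (increasing_pairs d) = d choose 2"
proof -
  have "card (increasing_pairs d) = card (SIGMA b:{..<d}. {..<b})"
    unfolding increasing_pairs_Sigma by (rule card_image) (auto simp: inj_on_def)
  also have "\<dots> = (\<Sum>b<d. b)" by simp
  also have "\<dots> = d choose 2"
    by (induction d) (simp_all add: numeral_2_eq_2)
  finally show ?thesis .
qed

context exterior_square
begin

interpretation VK: vector_space_pair sV "(*) :: 'k \<Rightarrow> 'k \<Rightarrow> 'k"
  using V.vector_space_axioms vector_space_field by (rule vector_space_pair.intro)
interpretation WK: vector_space_pair sW "(*) :: 'k \<Rightarrow> 'k \<Rightarrow> 'k"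
  using W.vector_space_axioms vector_space_field by (rule vector_space_pair.intro)
interpretation VW: vector_space_pair sV sW by unfold_locales
interpretation VV: vector_space_pair sV sV by unfold_locales
interpretation WW: vector_space_pair sW sW by unfold_locales
interpretation D: Modules.module "dual_scale sW"
  by (rule module_dual_scale) unfold_locales

lemma linear_wedge_right: "Vector_Spaces.linear sV sW (wedge x)"
  and linear_wedge_left: "Vector_Spaces.linear sV sW (\<lambda>x. wedge x y)"
  and wedge_self [simp]: "wedge x x = 0"
  using alternating_wedge by (auto simp: alternating_bilinear_def)

lemmas wedge_right =
    VW.linear_0[OF linear_wedge_right] VW.linear_add[OF linear_wedge_right]
    VW.linear_scale[OF linear_wedge_right] VW.linear_diff[OF linear_wedge_right]
    VW.linear_neg[OF linear_wedge_right]
  and wedge_left =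
    VW.linear_0[OF linear_wedge_left] VW.linear_add[OF linear_wedge_left]
    VW.linear_scale[OF linear_wedge_left] VW.linear_diff[OF linear_wedge_left]
    VW.linear_neg[OF linear_wedge_left]

lemma wedge_skew: "wedge y x = - wedge x y"
proof -
  have "wedge (x + y) (x + y) = wedge x y + wedge y x"
    unfolding wedge_left(2) wedge_right(2) by simp
  hence "wedge x y + wedge y x = 0" unfolding wedge_self by (rule sym)
  thus ?thesis by (simp add: eq_neg_iff_add_eq_0 add.commute)
qed

lemma bilinear_in_subspace:
  assumes lin: "\<And>u. Vector_Spaces.linear sV sW (f u)" "\<And>v. Vector_Spaces.linear sV sW (\<lambda>u. f u v)"
    and S: "W.subspace S" and gen: "\<And>a b. a \<in> A \<Longrightarrow> b \<in> B \<Longrightarrow> f a b \<in> S"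
    and u: "u \<in> V.span A" and v: "v \<in> V.span B"
  shows "f u v \<in> S"
proof -
  have sub: "V.subspace (f a -` S)" "V.subspace ((\<lambda>a. f a b) -` S)" for a b
    using VW.linear_subspace_vimage[OF lin(1) S] VW.linear_subspace_vimage[OF lin(2) S] by auto
  have "f a v \<in> S" if "a \<in> A" for a
    using V.span_minimal[OF _ sub(1)[of a], of B] gen[OF that] v by blast
  thus ?thesis
    using V.span_minimal[OF _ sub(2)[of v], of A] u by blast
qed

lemma wedge_in_subspace:
  assumes "W.subspace S" and "\<And>a b. a \<in> A \<Longrightarrow> b \<in> B \<Longrightarrow> wedge a b \<in> S"
    and "x \<in> V.span A" "y \<in> V.span B"
  shows "wedge x y \<in> S"
  using bilinear_in_subspace[OF linear_wedge_right linear_wedge_left assms] .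

text \<open>
  Linear functionals on \<open>W\<close> are the same as alternating forms on \<open>V\<close>; the \<open>2 \<times> 2\<close> minors of a pair of
  functionals on \<open>V\<close> are the Pluecker coordinates. They detect independence of bivectors.
\<close>

lemma minor_functional:
  assumes f: "Vector_Spaces.linear sV (*) f" and g: "Vector_Spaces.linear sV (*) g"
  obtains h where "Vector_Spaces.linear sW (*) h"
    and "\<And>x y. h (wedge x y) = f x * g y - g x * f y"
proof -
  have lin: "Vector_Spaces.linear sV (*) (\<lambda>y. a * g y - b * f y)"
    "Vector_Spaces.linear sV (*) (\<lambda>x. a * f x - b * g x)" for a b
    by (intro VK.linear_compose_sub VK.linear_compose_scale_right f g)+
  have "Vector_Spaces.linear sV (*) (\<lambda>x. f x * a - g x * b)" for a b
    using lin(2)[of a b] by (simp only: mult.commute[of a] mult.commute[of b])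
  with lin(1) have "alternating_bilinear sV (*) (\<lambda>x y. f x * g y - g x * f y)"
    by (simp add: alternating_bilinear_def)
  from universal[OF this] show ?thesis using that by blast
qed

lemma independent_family_wedge:
  assumes "independent_family sV e {..<d}"
  shows "independent_family sW (\<lambda>(a, b). wedge (e a) (e b)) (increasing_pairs d)"
proof -
  obtain l where l: "\<And>a. Vector_Spaces.linear sV (*) (l a)"
    and dual: "\<And>a b. b \<in> {..<d} \<Longrightarrow> l a (e b) = (if a = b then 1 else 0)"
    using independent_family_dual[OF V.vector_space_axioms finite_lessThan assms] by blast
  have "\<exists>h. Vector_Spaces.linear sW (*) h \<and>
      (\<forall>x y. h (wedge x y) = l (fst p) x * l (snd p) y - l (snd p) x * l (fst p) y)" for p
    by (rule minor_functional[OF l[of "fst p"] l[of "snd p"]]) blast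
  then obtain h where h: "\<And>p. Vector_Spaces.linear sW (*) (h p)"
    and h_wedge: "\<And>p x y. h p (wedge x y) =
      l (fst p) x * l (snd p) y - l (snd p) x * l (fst p) y"
    using choice[of "\<lambda>p h. Vector_Spaces.linear sW (*) h \<and>
      (\<forall>x y. h (wedge x y) = l (fst p) x * l (snd p) y - l (snd p) x * l (fst p) y)"] by blast
  show ?thesis
  proof (rule independent_familyI_dual[OF finite_increasing_pairs h])
    fix p q assume "p \<in> increasing_pairs d" "q \<in> increasing_pairs d"
    then obtain a b a' b' where "p = (a, b)" "q = (a', b')"
      and "a < b" "b < d" "a' < b'" "b' < d"
      by (auto simp: increasing_pairs_def)
    thus "h p (case q of (a, b) \<Rightarrow> wedge (e a) (e b)) = (if p = q then 1 else 0)"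
      by (simp add: h_wedge dual)
  qed
qed

lemma span_wedge_basis:
  assumes "V.span (e ` {..<d}) = UNIV"
  shows "W.span ((\<lambda>(a, b). wedge (e a) (e b)) ` increasing_pairs d) = UNIV"
proof -
  let ?S = "W.span ((\<lambda>(a, b). wedge (e a) (e b)) ` increasing_pairs d)"
  have inc: "wedge (e a) (e b) \<in> ?S" if "a < b" "b < d" for a b
    using that by (intro W.span_base) (force simp: increasing_pairs_def)
  have gen: "wedge (e a) (e b) \<in> ?S" if "a < d" "b < d" for a b
  proof (cases a b rule: linorder_cases)
    case greater
    thus ?thesis
      using W.span_neg[OF inc[OF greater that(1)]] by (simp add: wedge_skew[of "e a"])
  qed (use inc that W.span_zero in auto)
  have "wedge x y \<in> ?S" for x y
    by (rule wedge_in_subspace[of _ "e ` {..<d}" "e ` {..<d}"])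
      (use gen assms in \<open>auto simp: W.subspace_span\<close>)
  hence "{wedge x y |x y. True} \<subseteq> ?S" by blast
  hence "W.span {wedge x y |x y. True} \<subseteq> ?S" by (rule W.span_minimal) (rule W.subspace_span)
  thus ?thesis using span_wedge by blast
qed

lemma dim_W:
  assumes "independent_family sV e {..<d}" "V.span (e ` {..<d}) = UNIV"
  shows "W.dim UNIV = d choose 2"
proof -
  let ?B = "(\<lambda>(a, b). wedge (e a) (e b)) ` increasing_pairs d"
  have "W.independent ?B \<and> card ?B = d choose 2"
    using independent_family_wedge[OF assms(1)] card_increasing_pairs[of d]
    by (simp add: independent_family_iff[OF W.vector_space_axioms finite_increasing_pairs]
        card_image)
  thus ?thesis
    using W.basis_card_eq_dim[of ?B UNIV] span_wedge_basis[OF assms(2)] by simp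
qed

text \<open>
  Contraction with a functional recovers the vectors of a plane linearly from its Pluecker vector. It
  turns conditions on the plane into polynomial conditions on the bivector.
\<close>

lemma contraction:
  assumes f: "Vector_Spaces.linear sV (*) f"
  obtains g where "Vector_Spaces.linear sW sV g"
    and "\<And>x y. g (wedge x y) = sV (f x) y - sV (f y) x"
proof -
  have lin: "Vector_Spaces.linear sV sV (\<lambda>x. sV (f x) y)" "Vector_Spaces.linear sV sV (sV a)" for y a
    using Vector_Spaces.linear_compose[OF f V.linear_scale_left[of y]] V.linear_scale_self
    by (simp_all add: o_def)
  have "alternating_bilinear sV sV (\<lambda>x y. sV (f x) y - sV (f y) x)"
    unfolding alternating_bilinear_def by (simp add: lin VV.linear_compose_sub)
  from universal_property[OF V.vector_space_axioms this] show ?thesis using that by blast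
qed

lemma wedge_nonzero_iff: "wedge x y \<noteq> 0 \<longleftrightarrow> x \<noteq> y \<and> V.independent {x, y}"
proof
  assume nz: "wedge x y \<noteq> 0"
  have "x \<notin> V.span {y}"
  proof
    assume "x \<in> V.span {y}"
    then obtain c where "x = sV c y" by (auto simp: V.span_singleton)
    thus False using nz by (simp add: wedge_left)
  qed
  moreover have "y \<noteq> 0" using nz by (auto simp: wedge_right)
  ultimately show "x \<noteq> y \<and> V.independent {x, y}"
    using V.span_base[of y "{y}"] by (auto simp: V.independent_insert)
next
  assume ind: "x \<noteq> y \<and> V.independent {x, y}"
  obtain f where f: "Vector_Spaces.linear sV (*) f" "f x = 1" "f y = 0"
    using VK.linear_independent_extend[of "{x, y}" "\<lambda>v. if v = x then 1 else 0"] ind by auto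
  obtain g where g: "Vector_Spaces.linear sV (*) g" "g x = 0" "g y = 1"
    using VK.linear_independent_extend[of "{x, y}" "\<lambda>v. if v = y then 1 else 0"] ind by auto
  obtain h where h: "Vector_Spaces.linear sW (*) h"
    and h_wedge: "\<And>x y. h (wedge x y) = f x * g y - g x * f y"
    using minor_functional[OF f(1) g(1)] by blast
  have "h (wedge x y) = 1" by (simp add: h_wedge f g)
  thus "wedge x y \<noteq> 0" using WK.linear_0[OF h] by force
qed

lemma span_plane_in_Gr:
  assumes "wedge x y \<noteq> 0"
  shows "V.span {x, y} \<in> Gr sV 2"
  using assms V.dim_span_eq_card_independent[of "{x, y}"] unfolding wedge_nonzero_iff
  by (simp add: Gr_def V.subspace_span)

lemma Gr2E:
  assumes "L \<in> Gr sV 2"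
  obtains x y where "L = V.span {x, y}" "wedge x y \<noteq> 0"
proof -
  have L: "V.subspace L" "V.dim L = 2" using assms by (auto simp: Gr_def)
  obtain B where B: "B \<subseteq> L" "V.independent B" "L \<subseteq> V.span B" "card B = V.dim L"
    by (rule V.basis_exists)
  then obtain x y where xy: "B = {x, y}" "x \<noteq> y" using L(2) by (auto simp: card_2_iff)
  have "V.span B \<subseteq> L" using B(1) L(1) by (rule V.span_minimal)
  with B(2,3) xy show ?thesis
    by (intro that[of x y]) (auto simp: wedge_nonzero_iff)
qed

lemma ext2_plane: "ext2 sW wedge (V.span {x, y}) = W.span {wedge x y}"
proof -
  have "wedge u v \<in> W.span {wedge x y}" if "u \<in> V.span {x, y}" "v \<in> V.span {x, y}" for u v
    using W.span_base[of "wedge x y" "{wedge x y}"] W.span_neg[of "wedge x y" "{wedge x y}"]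
    by (intro wedge_in_subspace[OF W.subspace_span _ that])
      (auto simp: W.span_zero wedge_skew[of y x])
  hence "ext2 sW wedge (V.span {x, y}) \<subseteq> W.span {wedge x y}"
    unfolding ext2_def by (intro W.span_minimal) (auto simp: W.subspace_span)
  moreover have "W.span {wedge x y} \<subseteq> ext2 sW wedge (V.span {x, y})"
    unfolding ext2_def by (intro W.span_mono) (auto intro: V.span_base)
  ultimately show ?thesis by blast
qed

section \<open>Frames\<close>

text \<open>
  A tuple of planes is handled through a frame, that is a choice of spanning vectors \<open>x i, y i\<close> of
  each plane. The bivectors of the frame are then its Pluecker vectors. The
  restriction to \<open>{..<r}\<close> makes \<open>planes\<close> extensional, as the members of the product are.
\<close>

definition planes :: "nat \<Rightarrow> (nat \<Rightarrow> 'v) \<Rightarrow> (nat \<Rightarrow> 'v) \<Rightarrow> nat \<Rightarrow> 'v set" where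
  "planes r x y = (\<lambda>i\<in>{..<r}. V.span {x i, y i})"

definition bivectors :: "(nat \<Rightarrow> 'v) \<Rightarrow> (nat \<Rightarrow> 'v) \<Rightarrow> nat \<Rightarrow> 'w" where
  "bivectors x y = (\<lambda>i. wedge (x i) (y i))"

lemma planes_in_Gr2_power:
  "(\<And>i. i < r \<Longrightarrow> bivectors x y i \<noteq> 0) \<Longrightarrow> planes r x y \<in> Gr2_power sV r"
  by (auto simp: planes_def bivectors_def span_plane_in_Gr)

lemma Gr2_powerE:
  assumes "L \<in> Gr2_power sV r"
  obtains x y where "L = planes r x y" "\<And>i. i < r \<Longrightarrow> bivectors x y i \<noteq> 0"
proof -
  have "\<forall>i. \<exists>p. i < r \<longrightarrow> L i = V.span {fst p, snd p} \<and> wedge (fst p) (snd p) \<noteq> 0"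
  proof
    fix i show "\<exists>p. i < r \<longrightarrow> L i = V.span {fst p, snd p} \<and> wedge (fst p) (snd p) \<noteq> 0"
    proof (cases "i < r")
      case True
      hence "L i \<in> Gr sV 2" using assms by auto
      then obtain x y where "L i = V.span {x, y}" "wedge x y \<noteq> 0" by (rule Gr2E)
      thus ?thesis by (intro exI[of _ "(x, y)"]) simp
    qed simp
  qed
  then obtain p where p: "\<And>i. i < r \<Longrightarrow>
      L i = V.span {fst (p i), snd (p i)} \<and> wedge (fst (p i)) (snd (p i)) \<noteq> 0"
    using choice[of "\<lambda>i p. i < r \<longrightarrow> L i = V.span {fst p, snd p} \<and> wedge (fst p) (snd p) \<noteq> 0"]
    by blast
  have "L = planes r (\<lambda>i. fst (p i)) (\<lambda>i. snd (p i))"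
    using assms p by (intro ext) (auto simp: planes_def PiE_def extensional_def)
  with p show ?thesis by (intro that) (auto simp: bivectors_def)
qed

lemma independent_bivectors_nonzero:
  assumes "independent_family sW (bivectors x y) {..<r}" "i < r"
  shows "bivectors x y i \<noteq> 0"
proof
  assume "bivectors x y i = 0"
  hence "(\<Sum>j<r. sW (if j = i then 1 else 0) (bivectors x y j)) = 0"
    by (intro sum.neutral) auto
  hence "(if i = i then 1 else 0 :: 'k) = 0"
    using assms(1)[unfolded independent_family_def, rule_format, of "\<lambda>j. if j = i then 1 else 0" i]
      assms(2) by simp
  thus False by simp
qed

lemma planes_in_domain_iff:
  assumes nz: "\<And>i. i < r \<Longrightarrow> bivectors x y i \<noteq> 0"
  shows "planes r x y \<in> Psi_domain sV sW wedge r \<longleftrightarrow>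
    independent_family sW (bivectors x y) {..<r}"
proof -
  have ext2: "ext2 sW wedge (planes r x y i) = W.span {bivectors x y i}" if "i < r" for i
    using that by (simp add: planes_def ext2_plane bivectors_def)
  have "independent_family sW (bivectors x y) {..<r} \<longleftrightarrow>
    (\<forall>w. (\<forall>i<r. w i \<in> ext2 sW wedge (planes r x y i)) \<longrightarrow> (\<Sum>i<r. w i) = 0 \<longrightarrow> (\<forall>i<r. w i = 0))"
  proof (intro iffI allI impI)
    fix w i assume ind: "independent_family sW (bivectors x y) {..<r}"
      and w: "\<forall>i<r. w i \<in> ext2 sW wedge (planes r x y i)" "(\<Sum>i<r. w i) = 0" and i: "i < r"
    have "\<forall>i. \<exists>c. i < r \<longrightarrow> w i = sW c (bivectors x y i)"
      using w(1) ext2 by (auto simp: W.span_singleton)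
    then obtain c where c: "\<And>i. i < r \<Longrightarrow> w i = sW (c i) (bivectors x y i)"
      using choice[of "\<lambda>i c. i < r \<longrightarrow> w i = sW c (bivectors x y i)"] by blast
    have "(\<Sum>i<r. sW (c i) (bivectors x y i)) = (\<Sum>i<r. w i)"
      by (rule sum.cong) (simp_all add: c)
    hence "\<forall>i\<in>{..<r}. c i = 0" using ind w(2) unfolding independent_family_def by simp
    thus "w i = 0" using c[OF i] i by simp
  next
    assume dom: "\<forall>w. (\<forall>i<r. w i \<in> ext2 sW wedge (planes r x y i)) \<longrightarrow>
      (\<Sum>i<r. w i) = 0 \<longrightarrow> (\<forall>i<r. w i = 0)"
    show "independent_family sW (bivectors x y) {..<r}"
      unfolding independent_family_def
    proof (intro allI impI ballI)
      fix c i assume sum: "(\<Sum>i<r. sW (c i) (bivectors x y i)) = 0" and i: "i \<in> {..<r}"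
      have "\<forall>i<r. sW (c i) (bivectors x y i) \<in> ext2 sW wedge (planes r x y i)"
        using ext2 W.span_base by (auto intro!: W.span_scale)
      hence "\<forall>i<r. sW (c i) (bivectors x y i) = 0"
        by (rule dom[THEN spec, of "\<lambda>i. sW (c i) (bivectors x y i)", THEN mp, THEN mp, OF _ sum])
      thus "c i = 0" using nz i by simp
    qed
  qed
  thus ?thesis using planes_in_Gr2_power[of r x y] nz by (simp add: Psi_domain_def)
qed

lemma Psi_domainE:
  assumes "L \<in> Psi_domain sV sW wedge r"
  obtains x y where "L = planes r x y" "independent_family sW (bivectors x y) {..<r}"
proof -
  have "L \<in> Gr2_power sV r" using assms by (simp add: Psi_domain_def)
  then obtain x y where xy: "L = planes r x y" "\<And>i. i < r \<Longrightarrow> bivectors x y i \<noteq> 0"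
    by (rule Gr2_powerE) blast
  show ?thesis using that[OF xy(1)] planes_in_domain_iff[of r x y, OF xy(2)] assms xy(1) by simp
qed

text \<open>
  For independent \<open>x\<close>, \<open>y\<close> this is, up to taking the span, the subspace \<open>V \<and> L\<close> attached to the
  plane \<open>L = \<langle>x, y\<rangle>\<close>: the affine tangent space at \<open>x \<and> y\<close> to the cone of decomposable bivectors.
\<close>

definition osculating :: "'v \<Rightarrow> 'v \<Rightarrow> 'w set" where
  "osculating x y = {wedge z v |z v. v \<in> V.span {x, y}}"

text \<open>
  The spanning set of \<open>V \<and> L\<^sub>i + \<langle>\<omega>\<^sub>0, \<dots>, \<omega>\<^sub>r\<^sub>-\<^sub>1\<rangle>\<close>, written as linear images of the individual
  Pluecker vectors \<open>\<omega>\<^sub>j\<close>. A pair \<open>(T, j)\<close> stands for the vector \<open>T \<omega>\<^sub>j\<close>; this is the form to which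
  \<open>spanning_minor\<close> applies. The maps \<open>g\<close> include all contractions, which together produce every
  vector of \<open>L\<^sub>i\<close> from \<open>\<omega>\<^sub>i\<close>, and they never leave \<open>L\<^sub>i\<close>.
\<close>

definition columns :: "nat \<Rightarrow> nat \<Rightarrow> (('w \<Rightarrow> 'w) \<times> nat) set" where
  "columns r i =
     {(\<lambda>w. wedge z (g w), i) |z g. Vector_Spaces.linear sW sV g \<and> (\<forall>x y. g (wedge x y) \<in> V.span {x, y})} \<union>
     {(\<lambda>w. w, j) |j. j < r}"

lemma columns_linear:
  assumes "(T, j) \<in> columns r i" "i < r"
  shows "Vector_Spaces.linear sW sW T \<and> j < r"
proof -
  have "Vector_Spaces.linear sW sW (\<lambda>w. wedge z (g w))" if "Vector_Spaces.linear sW sV g" for z g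
    using Vector_Spaces.linear_compose[OF that linear_wedge_right[of z]] by (simp add: o_def)
  thus ?thesis using assms W.linear_ident by (auto simp: columns_def)
qed

text \<open>
  The functionals dual to \<open>x i, y i\<close> give contractions that map \<open>x i \<and> y i\<close> to \<open>y i\<close> and to \<open>- x i\<close>.
  So the columns contain \<open>V \<and> x i\<close> and \<open>V \<and> y i\<close> up to sign.
\<close>

lemma span_columns:
  assumes nz: "bivectors x y i \<noteq> 0"
  shows "W.span ((\<lambda>(T, j). T (bivectors x y j)) ` columns r i) =
    W.span (osculating (x i) (y i) \<union> bivectors x y ` {..<r})" (is "W.span ?C = W.span ?D")
proof -
  have "?C \<subseteq> ?D" by (fastforce simp: columns_def osculating_def bivectors_def)
  moreover have "?D \<subseteq> W.span ?C"
  proof -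
    have ind: "x i \<noteq> y i \<and> V.independent {x i, y i}"
      using nz by (simp add: bivectors_def wedge_nonzero_iff)
    have col: "wedge z (sV (f (x i)) (y i) - sV (f (y i)) (x i)) \<in> W.span ?C"
      if f: "Vector_Spaces.linear sV (*) f" for f z
    proof -
      obtain g where g: "Vector_Spaces.linear sW sV g"
        and g_wedge: "\<And>x y. g (wedge x y) = sV (f x) y - sV (f y) x"
        using contraction[OF f] by blast
      have "\<forall>x y. g (wedge x y) \<in> V.span {x, y}"
        unfolding g_wedge by (intro allI V.span_diff V.span_scale V.span_base) auto
      with g have "(\<lambda>w. wedge z (g w), i) \<in> columns r i" by (auto simp: columns_def)
      hence "wedge z (g (bivectors x y i)) \<in> ?C" by (rule rev_image_eqI) simp
      thus ?thesis using W.span_base by (simp add: g_wedge bivectors_def)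
    qed
    obtain f where f: "Vector_Spaces.linear sV (*) f" "f (x i) = 1" "f (y i) = 0"
      using VK.linear_independent_extend[of "{x i, y i}" "\<lambda>v. if v = x i then 1 else 0"] ind by auto
    obtain f' where f': "Vector_Spaces.linear sV (*) f'" "f' (x i) = 0" "f' (y i) = 1"
      using VK.linear_independent_extend[of "{x i, y i}" "\<lambda>v. if v = y i then 1 else 0"] ind by auto
    have yi: "wedge z (y i) \<in> W.span ?C" for z using col[OF f(1), of z] f by simp
    have "- wedge z (x i) \<in> W.span ?C" for z
      using col[OF f'(1), of z] f' by (simp add: wedge_right)
    hence xi: "wedge z (x i) \<in> W.span ?C" for z using W.span_neg by fastforce
    have "wedge z v \<in> W.span ?C" if "v \<in> V.span {x i, y i}" for z v
      by (rule wedge_in_subspace[OF W.subspace_span _ _ that, of UNIV]) (use xi yi in auto)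
    moreover have "bivectors x y j \<in> ?C" if "j < r" for j
      using that by (intro rev_image_eqI[of "(\<lambda>w. w, j)"]) (auto simp: columns_def)
    ultimately show ?thesis using W.span_base by (auto simp: osculating_def)
  qed
  ultimately show ?thesis
    by (intro subset_antisym W.span_mono W.span_minimal W.subspace_span)
qed


section \<open>The differential\<close>

lemma Psi_planes: "Psi sW wedge r (planes r x y) = W.span (bivectors x y ` {..<r})"
proof -
  have "(\<Union>i<r. ext2 sW wedge (planes r x y i)) = (\<Union>i<r. W.span {bivectors x y i})"
    by (simp add: planes_def ext2_plane bivectors_def)
  moreover have "W.span (\<Union>i<r. W.span {bivectors x y i}) = W.span (bivectors x y ` {..<r})"
  proof (rule subset_antisym)
    have "W.span {bivectors x y i} \<subseteq> W.span (bivectors x y ` {..<r})" if "i < r" for i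
      using that by (intro W.span_mono) auto
    thus "W.span (\<Union>i<r. W.span {bivectors x y i}) \<subseteq> W.span (bivectors x y ` {..<r})"
      by (intro W.span_minimal W.subspace_span) auto
    show "W.span (bivectors x y ` {..<r}) \<subseteq> W.span (\<Union>i<r. W.span {bivectors x y i})"
      by (intro W.span_mono) (auto intro: W.span_base)
  qed
  ultimately show ?thesis by (simp add: Psi_def)
qed

text \<open>
  The defect of \<open>\<Phi>\<close> from the Leibniz rule is bilinear and alternating, so on a plane it is controlled
  by its value on a single frame.
\<close>

lemma derivation_on_plane:
  assumes S: "W.subspace S" and phi: "Vector_Spaces.linear sV sV \<phi>"
    and Phi: "Vector_Spaces.linear sW sW \<Phi>"
    and base: "\<Phi> (wedge x y) - (wedge (\<phi> x) y + wedge x (\<phi> y)) \<in> S"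
    and u: "u \<in> V.span {x, y}" and v: "v \<in> V.span {x, y}"
  shows "\<Phi> (wedge u v) - (wedge (\<phi> u) v + wedge u (\<phi> v)) \<in> S"
proof (rule bilinear_in_subspace[OF _ _ S _ u v])
  note comp = Vector_Spaces.linear_compose[unfolded o_def]
  show "Vector_Spaces.linear sV sW (\<lambda>v. \<Phi> (wedge u v) - (wedge (\<phi> u) v + wedge u (\<phi> v)))" for u
    by (intro VW.linear_compose_sub VW.linear_compose_add comp[OF linear_wedge_right Phi]
        linear_wedge_right comp[OF phi linear_wedge_right])
  show "Vector_Spaces.linear sV sW (\<lambda>u. \<Phi> (wedge u v) - (wedge (\<phi> u) v + wedge u (\<phi> v)))" for v
    by (intro VW.linear_compose_sub VW.linear_compose_add comp[OF linear_wedge_left Phi]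
        linear_wedge_left comp[OF phi linear_wedge_left])
  fix a b assume "a \<in> {x, y}" "b \<in> {x, y}"
  moreover have "\<Phi> (wedge c c) - (wedge (\<phi> c) c + wedge c (\<phi> c)) = 0" for c
    by (simp add: WW.linear_0[OF Phi] wedge_skew[of c "\<phi> c"])
  moreover have "\<Phi> (wedge y x) - (wedge (\<phi> y) x + wedge y (\<phi> x)) =
      - (\<Phi> (wedge x y) - (wedge (\<phi> x) y + wedge x (\<phi> y)))"
    by (simp add: wedge_skew[of y] wedge_skew[of "\<phi> y"] WW.linear_neg[OF Phi])
  ultimately show "\<Phi> (wedge a b) - (wedge (\<phi> a) b + wedge a (\<phi> b)) \<in> S"
    using base W.subspace_0[OF S] W.subspace_neg[OF S base] by auto
qed

lemma tangent_graph_subspace: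
  assumes Phi: "Vector_Spaces.linear sW sW \<Phi>" and L: "W.subspace L"
  shows "D.subspace {(w, w'). w \<in> L \<and> w' - \<Phi> w \<in> L}"
proof -
  have "{(w, w'). w \<in> L \<and> w' - \<Phi> w \<in> L} \<in> tangent_Gr sW L"
    unfolding tangent_Gr_iff[OF W.vector_space_axioms L] using Phi by blast
  thus ?thesis by (simp add: tangent_Gr_def)
qed

text \<open>
  The differential of \<open>\<Psi>\<close>: if the tangent vector at \<open>L\<^sub>i\<close> is the class of
  \<open>\<phi> i : L\<^sub>i \<rightarrow> V / L\<^sub>i\<close>, then the image is the class of any \<open>\<Phi>\<close> that sends \<open>x\<^sub>i \<and> y\<^sub>i\<close> to
  \<open>\<phi> i x\<^sub>i \<and> y\<^sub>i + x\<^sub>i \<and> \<phi> i y\<^sub>i\<close> modulo the span \<open>\<Lambda>\<close> of the bivectors. This is the Leibniz rule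
  applied to \<open>(x + \<epsilon> \<phi> x) \<and> (y + \<epsilon> \<phi> y)\<close>, where \<open>\<epsilon> \<Lambda>\<close> lies in the image because \<open>\<epsilon>\<close> is a scalar.
\<close>

lemma Psi_tangent:
  defines "\<Lambda> x y r \<equiv> W.span (bivectors x y ` {..<r})"
  assumes phi: "\<And>i. i < r \<Longrightarrow> Vector_Spaces.linear sV sV (\<phi> i)"
    and Phi: "Vector_Spaces.linear sW sW \<Phi>"
    and base: "\<And>i. i < r \<Longrightarrow>
      \<Phi> (bivectors x y i) - (wedge (\<phi> i (x i)) (y i) + wedge (x i) (\<phi> i (y i))) \<in> \<Lambda> x y r"
    and M: "\<And>i. i < r \<Longrightarrow> M i =
      {(u, u'). u \<in> V.span {x i, y i} \<and> u' - \<phi> i u \<in> V.span {x i, y i}}"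
  shows "Psi (dual_scale sW) (dual_wedge wedge) r M =
    {(w, w'). w \<in> \<Lambda> x y r \<and> w' - \<Phi> w \<in> \<Lambda> x y r}" (is "?P = ?T")
proof -
  let ?L = "\<Lambda> x y r"
  let ?gen = "\<lambda>i. {dual_wedge wedge u v |u v. u \<in> M i \<and> v \<in> M i}"
  have L: "W.subspace ?L" by (simp add: \<Lambda>_def W.subspace_span)
  have wedge_L: "wedge u v \<in> ?L" if "i < r" "u \<in> V.span {x i, y i}" "v \<in> V.span {x i, y i}" for i u v
  proof -
    have "wedge u v \<in> ext2 sW wedge (V.span {x i, y i})"
      unfolding ext2_def using that by (intro W.span_base) blast
    also have "\<dots> = W.span {bivectors x y i}" by (simp add: ext2_plane bivectors_def)
    also have "\<dots> \<subseteq> ?L" unfolding \<Lambda>_def using that(1) by (intro W.span_mono) auto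
    finally show ?thesis .
  qed
  have deriv: "\<Phi> (wedge u v) - (wedge (\<phi> i u) v + wedge u (\<phi> i v)) \<in> ?L"
    if "i < r" "u \<in> V.span {x i, y i}" "v \<in> V.span {x i, y i}" for i u v
    using derivation_on_plane[OF L phi[OF that(1)] Phi base[OF that(1), unfolded bivectors_def] that(2,3)] .
  show ?thesis
  proof (rule subset_antisym)
    have dw: "dual_wedge wedge u v \<in> ?T" if i: "i < r" and u: "u \<in> M i" and v: "v \<in> M i" for i u v
    proof -
      define a b where "a = snd u - \<phi> i (fst u)" and "b = snd v - \<phi> i (fst v)"
      have uv: "fst u \<in> V.span {x i, y i}" "fst v \<in> V.span {x i, y i}"
        and ab: "a \<in> V.span {x i, y i}" "b \<in> V.span {x i, y i}"
        using u v unfolding M[OF i] a_def b_def by auto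
      have "wedge (fst u) (snd v) + wedge (snd u) (fst v) - \<Phi> (wedge (fst u) (fst v)) =
          (wedge (fst u) b + wedge a (fst v)) -
          (\<Phi> (wedge (fst u) (fst v)) - (wedge (\<phi> i (fst u)) (fst v) + wedge (fst u) (\<phi> i (fst v))))"
        by (simp add: a_def b_def wedge_left wedge_right)
      also have "\<dots> \<in> ?L"
        by (intro W.subspace_diff[OF L] W.subspace_add[OF L] wedge_L[OF i] deriv[OF i] uv ab)
      finally show ?thesis
        using wedge_L[OF i uv] by (simp add: dual_wedge_def)
    qed
    have "?gen i \<subseteq> ?T" if "i < r" for i
    proof
      fix z assume "z \<in> ?gen i"
      then obtain u v where "z = dual_wedge wedge u v" "u \<in> M i" "v \<in> M i" by blast
      thus "z \<in> ?T" using dw[OF that, of u v] by (simp only:)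
    qed
    hence "ext2 (dual_scale sW) (dual_wedge wedge) (M i) \<subseteq> ?T" if "i < r" for i
      unfolding ext2_def using that by (intro D.span_minimal[OF _ tangent_graph_subspace[OF Phi L]])
    thus "?P \<subseteq> ?T"
      unfolding Psi_def
      by (intro D.span_minimal[OF _ tangent_graph_subspace[OF Phi L]] UN_least) simp
  next
    have P: "D.subspace ?P" unfolding Psi_def by (rule D.subspace_span)
    have gen: "(wedge u v, wedge u (\<phi> i v) + wedge (\<phi> i u) v) \<in> ?P"
      if "i < r" "u \<in> V.span {x i, y i}" "v \<in> V.span {x i, y i}" for i u v
    proof -
      have "(u, \<phi> i u) \<in> M i" "(v, \<phi> i v) \<in> M i"
        using that by (auto simp: M V.span_zero)
      hence "dual_wedge wedge (u, \<phi> i u) (v, \<phi> i v) \<in> ?gen i" by blast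
      hence "dual_wedge wedge (u, \<phi> i u) (v, \<phi> i v) \<in> ext2 (dual_scale sW) (dual_wedge wedge) (M i)"
        unfolding ext2_def by (rule D.span_base)
      hence "dual_wedge wedge (u, \<phi> i u) (v, \<phi> i v) \<in> ?P"
        unfolding Psi_def using that(1) by (intro D.span_base) blast
      thus ?thesis by (simp add: dual_wedge_def)
    qed
    have biv: "(bivectors x y i, wedge (x i) (\<phi> i (y i)) + wedge (\<phi> i (x i)) (y i)) \<in> ?P"
      if "i < r" for i
      using gen[OF that, of "x i" "y i"] by (simp add: bivectors_def V.span_base)
    \<comment> \<open>The pairs \<open>(0, w)\<close> are the multiples of \<open>\<epsilon>\<close>; \<open>Dual 0 1\<close> below is \<open>\<epsilon>\<close> itself.\<close>
    have "W.subspace {w. (0, w) \<in> ?P}"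
    proof (rule W.subspaceI)
      show "0 \<in> {w. (0, w) \<in> ?P}"
        using D.subspace_0[OF P] by (simp add: zero_prod_def)
      show "v + w \<in> {w. (0, w) \<in> ?P}" if "v \<in> {w. (0, w) \<in> ?P}" "w \<in> {w. (0, w) \<in> ?P}" for v w
        using D.subspace_add[OF P, of "(0, v)" "(0, w)"] that by (simp add: plus_prod_def)
      show "sW c w \<in> {w. (0, w) \<in> ?P}" if "w \<in> {w. (0, w) \<in> ?P}" for c w
        using D.subspace_scale[OF P, of "(0, w)" "Dual c 0"] that by (simp add: dual_scale_def)
    qed
    moreover have "(0, bivectors x y i) \<in> ?P" if "i < r" for i
      using D.subspace_scale[OF P biv[OF that], of "Dual 0 1"] by (simp add: dual_scale_def)
    ultimately have eps: "(0, w) \<in> ?P" if "w \<in> ?L" for w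
      using W.span_minimal[of "bivectors x y ` {..<r}" "{w. (0, w) \<in> ?P}"] that
      unfolding \<Lambda>_def by blast
    have "W.subspace {w. (w, \<Phi> w) \<in> ?P}"
    proof (rule W.subspaceI)
      show "0 \<in> {w. (w, \<Phi> w) \<in> ?P}"
        using D.subspace_0[OF P] by (simp add: zero_prod_def WW.linear_0[OF Phi])
      show "v + w \<in> {w. (w, \<Phi> w) \<in> ?P}"
        if "v \<in> {w. (w, \<Phi> w) \<in> ?P}" "w \<in> {w. (w, \<Phi> w) \<in> ?P}" for v w
        using D.subspace_add[OF P, of "(v, \<Phi> v)" "(w, \<Phi> w)"] that
        by (simp add: plus_prod_def WW.linear_add[OF Phi])
      show "sW c w \<in> {w. (w, \<Phi> w) \<in> ?P}" if "w \<in> {w. (w, \<Phi> w) \<in> ?P}" for c w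
        using D.subspace_scale[OF P, of "(w, \<Phi> w)" "Dual c 0"] that
        by (simp add: dual_scale_def WW.linear_scale[OF Phi])
    qed
    moreover have "(bivectors x y i, \<Phi> (bivectors x y i)) \<in> ?P" if "i < r" for i
      using D.subspace_add[OF P biv[OF that] eps[OF base[OF that]]]
      by (simp add: plus_prod_def algebra_simps)
    ultimately have graph: "(w, \<Phi> w) \<in> ?P" if "w \<in> ?L" for w
      using W.span_minimal[of "bivectors x y ` {..<r}" "{w. (w, \<Phi> w) \<in> ?P}"] that
      unfolding \<Lambda>_def by blast
    show "?T \<subseteq> ?P"
    proof clarify
      fix w w' assume "w \<in> ?L" "w' - \<Phi> w \<in> ?L"
      thus "(w, w') \<in> ?P"
        using D.subspace_add[OF P graph[of w] eps[of "w' - \<Phi> w"]] by (simp add: plus_prod_def)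
    qed
  qed
qed

lemma osculating_spans_iff:
  "W.span (osculating x y \<union> B) = UNIV \<longleftrightarrow>
    (\<forall>u. \<exists>a b. u - (wedge a y + wedge x b) \<in> W.span B)"
proof
  assume span: "W.span (osculating x y \<union> B) = UNIV"
  let ?S = "{u. \<exists>a b. u - (wedge a y + wedge x b) \<in> W.span B}"
  have "W.subspace ?S"
  proof (rule W.subspaceI)
    show "0 \<in> ?S"
      by (auto intro!: exI[of _ 0] simp: wedge_left wedge_right W.span_zero)
    show "u + v \<in> ?S" if "u \<in> ?S" "v \<in> ?S" for u v
    proof -
      obtain a b a' b' where "u - (wedge a y + wedge x b) \<in> W.span B"
        "v - (wedge a' y + wedge x b') \<in> W.span B" using \<open>u \<in> ?S\<close> \<open>v \<in> ?S\<close> by blast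
      hence "(u - (wedge a y + wedge x b)) + (v - (wedge a' y + wedge x b')) \<in> W.span B"
        by (rule W.span_add)
      also have "(u - (wedge a y + wedge x b)) + (v - (wedge a' y + wedge x b')) =
          (u + v) - (wedge (a + a') y + wedge x (b + b'))"
        by (simp add: wedge_left wedge_right)
      finally show ?thesis by blast
    qed
    show "sW c u \<in> ?S" if "u \<in> ?S" for c u
    proof -
      obtain a b where "u - (wedge a y + wedge x b) \<in> W.span B" using \<open>u \<in> ?S\<close> by blast
      hence "sW c (u - (wedge a y + wedge x b)) \<in> W.span B" by (rule W.span_scale)
      also have "sW c (u - (wedge a y + wedge x b)) =
          sW c u - (wedge (sV c a) y + wedge x (sV c b))"
        by (simp add: wedge_left wedge_right W.scale_right_diff_distrib W.scale_right_distrib)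
      finally show ?thesis by blast
    qed
  qed
  moreover have "osculating x y \<subseteq> ?S"
  proof
    fix u assume "u \<in> osculating x y"
    then obtain z v where u: "u = wedge z v" and "v \<in> V.span {x, y}"
      by (auto simp: osculating_def)
    then obtain c where "v - sV c x \<in> V.span {y}" by (auto simp: V.span_breakdown_eq)
    then obtain c' where "v - sV c x = sV c' y" by (auto simp: V.span_singleton)
    hence v: "v = sV c x + sV c' y" by (simp add: algebra_simps)
    have "u - (wedge (sV c' z) y + wedge x (sV (- c) z)) = 0"
      by (simp add: u v wedge_left wedge_right wedge_skew[of z x])
    thus "u \<in> ?S" using W.span_zero[of B] unfolding mem_Collect_eq by metis
  qed
  moreover have "B \<subseteq> ?S"
  proof
    fix u assume "u \<in> B"
    hence "u - (wedge 0 y + wedge x 0) \<in> W.span B"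
      by (simp add: wedge_left wedge_right W.span_base)
    thus "u \<in> ?S" by blast
  qed
  ultimately have "W.span (osculating x y \<union> B) \<subseteq> ?S" by (intro W.span_minimal) auto
  thus "\<forall>u. \<exists>a b. u - (wedge a y + wedge x b) \<in> W.span B" using span by blast
next
  assume ex: "\<forall>u. \<exists>a b. u - (wedge a y + wedge x b) \<in> W.span B"
  have "u \<in> W.span (osculating x y \<union> B)" for u
  proof -
    obtain a b where ab: "u - (wedge a y + wedge x b) \<in> W.span B" using ex by blast
    have "wedge a y \<in> osculating x y" "wedge (- b) x \<in> osculating x y"
      by (auto simp: osculating_def intro!: V.span_base)
    hence "wedge a y + wedge (- b) x \<in> W.span (osculating x y \<union> B)"
      by (intro W.span_add W.span_base) auto
    moreover have "u - (wedge a y + wedge x b) \<in> W.span (osculating x y \<union> B)"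
      using ab W.span_mono[of B "osculating x y \<union> B"] by auto
    ultimately have "(u - (wedge a y + wedge x b)) + (wedge a y + wedge (- b) x) \<in>
        W.span (osculating x y \<union> B)" by (rule W.span_add[rotated])
    thus ?thesis by (simp add: wedge_left wedge_skew[of b])
  qed
  thus "W.span (osculating x y \<union> B) = UNIV" by blast
qed

text \<open>
  The tangent vectors \<open>\<phi> i\<close> can be chosen independently, and \<open>\<phi> i x\<^sub>i \<and> y\<^sub>i + x\<^sub>i \<and> \<phi> i y\<^sub>i\<close> ranges
  over all of \<open>V \<and> L\<^sub>i\<close>. Since the bivectors form a basis of \<open>\<Lambda>\<close>, a tangent vector \<open>\<Lambda> \<rightarrow> W / \<Lambda>\<close> of the
  target is an arbitrary tuple of classes modulo \<open>\<Lambda>\<close>. So surjectivity means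
  \<open>V \<and> L\<^sub>i + \<Lambda> = W\<close> for every \<open>i\<close> separately.
\<close>

lemma submersion_iff:
  assumes ind: "independent_family sW (bivectors x y) {..<r}"
  shows "Psi_submersion_at sV sW wedge r (planes r x y) \<longleftrightarrow>
    (\<forall>i<r. W.span (osculating (x i) (y i) \<union> bivectors x y ` {..<r}) = UNIV)"
proof -
  define \<Lambda> where "\<Lambda> = W.span (bivectors x y ` {..<r})"
  define \<tau> where "\<tau> \<phi> i = wedge (\<phi> (x i)) (y i) + wedge (x i) (\<phi> (y i))" for \<phi> i
  let ?dPsi = "Psi (dual_scale sW) (dual_wedge wedge) r"
  let ?TGr = "\<Pi>\<^sub>E i\<in>{..<r}. tangent_Gr sV (planes r x y i)"
  let ?graph = "\<lambda>\<Phi>. {(w, w'). w \<in> \<Lambda> \<and> w' - \<Phi> w \<in> \<Lambda>}"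
  have L: "W.subspace \<Lambda>" by (simp add: \<Lambda>_def W.subspace_span)
  have biv: "bivectors x y i \<in> \<Lambda>" if "i < r" for i
    using that by (simp add: \<Lambda>_def W.span_base)
  have tangent_V: "N \<in> tangent_Gr sV (planes r x y i) \<longleftrightarrow>
      (\<exists>\<phi>. Vector_Spaces.linear sV sV \<phi> \<and>
        N = {(u, u'). u \<in> V.span {x i, y i} \<and> u' - \<phi> u \<in> V.span {x i, y i}})"
    if "i < r" for i N
    using that tangent_Gr_iff[OF V.vector_space_axioms V.subspace_span] by (simp add: planes_def)
  have tangent_W: "N \<in> tangent_Gr sW \<Lambda> \<longleftrightarrow>
      (\<exists>\<Phi>. Vector_Spaces.linear sW sW \<Phi> \<and> N = ?graph \<Phi>)" for N
    by (rule tangent_Gr_iff[OF W.vector_space_axioms L])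
  have extend: "\<exists>\<Phi>. Vector_Spaces.linear sW sW \<Phi> \<and> (\<forall>i<r. \<Phi> (bivectors x y i) = h i)" for h
    by (rule independent_family_extend[OF W.vector_space_axioms W.vector_space_axioms
          finite_lessThan ind, of h]) auto
  have dPsi: "?dPsi M = ?graph \<Phi>"
    if "\<And>i. i < r \<Longrightarrow> Vector_Spaces.linear sV sV (\<phi> i)" "Vector_Spaces.linear sW sW \<Phi>"
      "\<And>i. i < r \<Longrightarrow> \<Phi> (bivectors x y i) - \<tau> (\<phi> i) i \<in> \<Lambda>"
      "\<And>i. i < r \<Longrightarrow> M i = {(u, u'). u \<in> V.span {x i, y i} \<and> u' - \<phi> i u \<in> V.span {x i, y i}}"
    for M \<phi> \<Phi>
    using Psi_tangent[of r \<phi> \<Phi> x y M] that unfolding \<Lambda>_def \<tau>_def by blast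
  have lift: "\<exists>\<phi>. (\<forall>i<r. Vector_Spaces.linear sV sV (\<phi> i)) \<and>
      (\<forall>i<r. M i = {(u, u'). u \<in> V.span {x i, y i} \<and> u' - \<phi> i u \<in> V.span {x i, y i}})"
    if "M \<in> ?TGr" for M
  proof -
    have "\<forall>i. \<exists>\<phi>. i < r \<longrightarrow> Vector_Spaces.linear sV sV \<phi> \<and>
        M i = {(u, u'). u \<in> V.span {x i, y i} \<and> u' - \<phi> u \<in> V.span {x i, y i}}"
      using that tangent_V by (auto simp: PiE_iff)
    from choice[OF this] show ?thesis by blast
  qed
  have "Psi_submersion_at sV sW wedge r (planes r x y) \<longleftrightarrow>
      ?dPsi ` ?TGr = tangent_Gr sW \<Lambda>"
    by (simp add: Psi_submersion_at_def Psi_planes \<Lambda>_def)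
  also have "\<dots> \<longleftrightarrow> (\<forall>i<r. \<forall>u. \<exists>a b. u - (wedge a (y i) + wedge (x i) b) \<in> \<Lambda>)"
  proof
    assume surj: "?dPsi ` ?TGr = tangent_Gr sW \<Lambda>"
    show "\<forall>i<r. \<forall>u. \<exists>a b. u - (wedge a (y i) + wedge (x i) b) \<in> \<Lambda>"
    proof (intro allI impI)
      fix i u assume i: "i < r"
      \<comment> \<open>That this tangent vector of the target is attained places its value \<open>u\<close> at the bivector
        with index \<open>i\<close> in \<open>V \<and> L\<^sub>i + \<Lambda>\<close>.\<close>
      obtain \<Phi> where \<Phi>: "Vector_Spaces.linear sW sW \<Phi>" "\<forall>j<r. \<Phi> (bivectors x y j) = u"
        using extend[of "\<lambda>_. u"] by blast
      have "?graph \<Phi> \<in> ?dPsi ` ?TGr" unfolding surj tangent_W using \<Phi>(1) by blast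
      then obtain M where M: "M \<in> ?TGr" "?graph \<Phi> = ?dPsi M" by blast
      obtain \<phi> where \<phi>: "\<forall>i<r. Vector_Spaces.linear sV sV (\<phi> i)"
        "\<forall>i<r. M i = {(u, u'). u \<in> V.span {x i, y i} \<and> u' - \<phi> i u \<in> V.span {x i, y i}}"
        using lift[OF M(1)] by blast
      obtain \<Phi>' where \<Phi>': "Vector_Spaces.linear sW sW \<Phi>'"
        "\<forall>i<r. \<Phi>' (bivectors x y i) = \<tau> (\<phi> i) i"
        using extend[of "\<lambda>i. \<tau> (\<phi> i) i"] by blast
      have "?dPsi M = ?graph \<Phi>'"
        by (rule dPsi[of \<phi>]) (use \<phi> \<Phi>' W.subspace_0[OF L] in auto)
      moreover have "(bivectors x y i, u) \<in> ?graph \<Phi>"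
        using biv[OF i] \<Phi>(2) i W.subspace_0[OF L] by simp
      ultimately have "(bivectors x y i, u) \<in> ?graph \<Phi>'" using M(2) by blast
      hence "u - \<tau> (\<phi> i) i \<in> \<Lambda>" using \<Phi>'(2) i by simp
      thus "\<exists>a b. u - (wedge a (y i) + wedge (x i) b) \<in> \<Lambda>" unfolding \<tau>_def by blast
    qed
  next
    assume ex: "\<forall>i<r. \<forall>u. \<exists>a b. u - (wedge a (y i) + wedge (x i) b) \<in> \<Lambda>"
    show "?dPsi ` ?TGr = tangent_Gr sW \<Lambda>"
    proof (rule subset_antisym; rule subsetI)
      fix N assume "N \<in> ?dPsi ` ?TGr"
      then obtain M where M: "M \<in> ?TGr" "N = ?dPsi M" by blast
      obtain \<phi> where \<phi>: "\<forall>i<r. Vector_Spaces.linear sV sV (\<phi> i)"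
        "\<forall>i<r. M i = {(u, u'). u \<in> V.span {x i, y i} \<and> u' - \<phi> i u \<in> V.span {x i, y i}}"
        using lift[OF M(1)] by blast
      obtain \<Phi> where \<Phi>: "Vector_Spaces.linear sW sW \<Phi>"
        "\<forall>i<r. \<Phi> (bivectors x y i) = \<tau> (\<phi> i) i"
        using extend[of "\<lambda>i. \<tau> (\<phi> i) i"] by blast
      have "?dPsi M = ?graph \<Phi>"
        by (rule dPsi[of \<phi>]) (use \<phi> \<Phi> W.subspace_0[OF L] in auto)
      thus "N \<in> tangent_Gr sW \<Lambda>" unfolding tangent_W M(2) using \<Phi>(1) by blast
    next
      fix N assume "N \<in> tangent_Gr sW \<Lambda>"
      then obtain \<Phi> where \<Phi>: "Vector_Spaces.linear sW sW \<Phi>" and N: "N = ?graph \<Phi>"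
        unfolding tangent_W by blast
      have "\<forall>i. \<exists>\<phi>. i < r \<longrightarrow> Vector_Spaces.linear sV sV \<phi> \<and> \<Phi> (bivectors x y i) - \<tau> \<phi> i \<in> \<Lambda>"
      proof
        fix i
        show "\<exists>\<phi>. i < r \<longrightarrow> Vector_Spaces.linear sV sV \<phi> \<and> \<Phi> (bivectors x y i) - \<tau> \<phi> i \<in> \<Lambda>"
        proof (cases "i < r")
          case i: True
          obtain a b where ab: "\<Phi> (bivectors x y i) - (wedge a (y i) + wedge (x i) b) \<in> \<Lambda>"
            using ex i by blast
          have xy: "x i \<noteq> y i" "V.independent {x i, y i}"
            using independent_bivectors_nonzero[OF ind i] wedge_nonzero_iff[of "x i" "y i"]
            unfolding bivectors_def by auto
          obtain \<phi> where "Vector_Spaces.linear sV sV \<phi>" "\<phi> (x i) = a" "\<phi> (y i) = b"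
            using VV.linear_independent_extend[OF xy(2), of "\<lambda>v. if v = x i then a else b"] xy(1)
            by auto
          with ab show ?thesis unfolding \<tau>_def by blast
        qed simp
      qed
      from choice[OF this] obtain \<phi> where
        \<phi>: "\<forall>i<r. Vector_Spaces.linear sV sV (\<phi> i) \<and> \<Phi> (bivectors x y i) - \<tau> (\<phi> i) i \<in> \<Lambda>"
        by blast
      define M where "M = (\<lambda>i\<in>{..<r}.
        {(u, u'). u \<in> V.span {x i, y i} \<and> u' - \<phi> i u \<in> V.span {x i, y i}})"
      have "M \<in> ?TGr"
      proof (rule PiE_I)
        fix i assume "i \<in> {..<r}"
        thus "M i \<in> tangent_Gr sV (planes r x y i)"
          using \<phi> tangent_V[of i] by (auto simp: M_def)
      qed (simp add: M_def)
      moreover have "?dPsi M = N"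
        unfolding N by (rule dPsi[of \<phi>]) (use \<phi> \<Phi> in \<open>auto simp: M_def\<close>)
      ultimately show "N \<in> ?dPsi ` ?TGr" by blast
    qed
  qed
  finally show ?thesis by (simp add: osculating_spans_iff \<Lambda>_def)
qed


section \<open>The Zariski topology\<close>

definition basic_open :: "nat \<Rightarrow> ((nat \<Rightarrow> 'w) \<Rightarrow> 'k) \<Rightarrow> (nat \<Rightarrow> 'v set) set" where
  "basic_open r F = {L \<in> Gr2_power sV r. \<forall>w. (\<forall>i<r. w i \<in> ext2 sW wedge (L i) - {0}) \<longrightarrow> F w \<noteq> 0}"

abbreviation Zariski :: "nat \<Rightarrow> (nat \<Rightarrow> 'v set) topology" where
  "Zariski r \<equiv> zariski_Gr2_power sV sW wedge r"

lemma openin_basic_open: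
  "F \<in> poly_funs sW r \<Longrightarrow> multihomogeneous sW r F \<Longrightarrow> openin (Zariski r) (basic_open r F)"
  unfolding zariski_Gr2_power_def
  by (rule topology_generated_by_Basis) (auto simp: basic_open_def)

lemma planes_in_basic_open_iff:
  assumes F: "F \<in> poly_funs sW r" "multihomogeneous sW r F"
    and nz: "\<And>i. i < r \<Longrightarrow> bivectors x y i \<noteq> 0"
  shows "planes r x y \<in> basic_open r F \<longleftrightarrow> F (bivectors x y) \<noteq> 0"
proof -
  have ext2: "ext2 sW wedge (planes r x y i) = W.span {bivectors x y i}" if "i < r" for i
    using that by (simp add: planes_def ext2_plane bivectors_def)
  have "F w \<noteq> 0" if w: "\<forall>i<r. w i \<in> ext2 sW wedge (planes r x y i) - {0}"
    and F0: "F (bivectors x y) \<noteq> 0" for w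
  proof -
    have "\<forall>i. \<exists>c. i < r \<longrightarrow> w i = sW c (bivectors x y i)"
      using w ext2 by (auto simp: W.span_singleton)
    from choice[OF this] obtain c where c: "\<And>i. i < r \<Longrightarrow> w i = sW (c i) (bivectors x y i)"
      by blast
    have c0: "c i \<noteq> 0" if "i < r" for i using c[OF that] w that by auto
    obtain n where n: "\<forall>c w. F (\<lambda>i. sW (c i) (w i)) = (\<Prod>i<r. c i ^ n i) * F w"
      using F(2) by (auto simp: multihomogeneous_def)
    have "F w = F (\<lambda>i. sW (c i) (bivectors x y i))"
      by (rule poly_funs_cong[OF F(1)]) (rule c)
    also have "\<dots> = (\<Prod>i<r. c i ^ n i) * F (bivectors x y)" using n by blast
    also have "\<dots> \<noteq> 0" using c0 F0 by simp
    finally show ?thesis .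
  qed
  moreover have "\<forall>i<r. bivectors x y i \<in> ext2 sW wedge (planes r x y i) - {0}"
    using nz ext2 by (simp add: W.span_base)
  ultimately show ?thesis
    using planes_in_Gr2_power[of r x y] nz unfolding basic_open_def by blast
qed

text \<open>
  The generating family is closed under intersection, by multiplying the polynomials. So it is a base
  and not only a subbase, and a single polynomial cuts out a neighbourhood inside any open set.
\<close>

lemma Zariski_nbhd:
  assumes "openin (Zariski r) S" "L \<in> S"
  obtains F where "F \<in> poly_funs sW r" "multihomogeneous sW r F"
    and "L \<in> basic_open r F" "basic_open r F \<subseteq> S"
proof -
  let ?B = "{basic_open r F |F. F \<in> poly_funs sW r \<and> multihomogeneous sW r F}"
  have "generate_topology_on ?B S"
    using assms(1) unfolding zariski_Gr2_power_def basic_open_def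
    by (rule openin_topology_generated_by)
  hence "L \<in> S \<longrightarrow> (\<exists>F. F \<in> poly_funs sW r \<and> multihomogeneous sW r F \<and>
      L \<in> basic_open r F \<and> basic_open r F \<subseteq> S)"
  proof induction
    case (Int a b)
    show ?case
    proof
      assume "L \<in> a \<inter> b"
      then obtain F G where
        F: "F \<in> poly_funs sW r" "multihomogeneous sW r F" "L \<in> basic_open r F" "basic_open r F \<subseteq> a"
        and G: "G \<in> poly_funs sW r" "multihomogeneous sW r G" "L \<in> basic_open r G" "basic_open r G \<subseteq> b"
        using Int by blast
      have "basic_open r (\<lambda>w. F w * G w) = basic_open r F \<inter> basic_open r G"
        by (auto simp: basic_open_def)
      with F G show "\<exists>F. F \<in> poly_funs sW r \<and> multihomogeneous sW r F \<and>
          L \<in> basic_open r F \<and> basic_open r F \<subseteq> a \<inter> b"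
        by (intro exI[of _ "\<lambda>w. F w * G w"] conjI poly_funs.mult multihomogeneous_mult) auto
    qed
  next
    case (UN K)
    thus ?case by blast
  qed auto
  with assms(2) show ?thesis using that by blast
qed

lemma topspace_Zariski: "topspace (Zariski r) = Gr2_power sV r"
proof
  show "topspace (Zariski r) \<subseteq> Gr2_power sV r"
    unfolding zariski_Gr2_power_def topology_generated_by_topspace by blast
  have "openin (Zariski r) (basic_open r (\<lambda>_. 1))"
    by (rule openin_basic_open[OF poly_funs.const multihomogeneous_const])
  thus "Gr2_power sV r \<subseteq> topspace (Zariski r)"
    using openin_subset by (fastforce simp: basic_open_def)
qed

lemma poly_funs_along_line:
  assumes "F \<in> poly_funs sW r"
  shows "\<exists>p. \<forall>t. F (bivectors (\<lambda>i. x i + sV t (x' i)) (\<lambda>i. y i + sV t (y' i))) = poly p t"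
  using assms
proof induction
  case (const c)
  show ?case by (rule exI[of _ "[:c:]"]) simp
next
  case (coord i l)
  let ?p = "[:l (wedge (x i) (y i)), l (wedge (x i) (y' i)) + l (wedge (x' i) (y i)),
    l (wedge (x' i) (y' i)):]"
  show ?case
    by (rule exI[of _ ?p])
      (simp add: bivectors_def wedge_left wedge_right WK.linear_add[OF coord(2)]
        WK.linear_scale[OF coord(2)] distrib_left)
next
  case (add F G)
  then obtain p q where
    "\<forall>t. F (bivectors (\<lambda>i. x i + sV t (x' i)) (\<lambda>i. y i + sV t (y' i))) = poly p t"
    "\<forall>t. G (bivectors (\<lambda>i. x i + sV t (x' i)) (\<lambda>i. y i + sV t (y' i))) = poly q t" by blast
  thus ?case by (intro exI[of _ "p + q"]) simp
next
  case (mult F G)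
  then obtain p q where
    "\<forall>t. F (bivectors (\<lambda>i. x i + sV t (x' i)) (\<lambda>i. y i + sV t (y' i))) = poly p t"
    "\<forall>t. G (bivectors (\<lambda>i. x i + sV t (x' i)) (\<lambda>i. y i + sV t (y' i))) = poly q t" by blast
  thus ?case by (intro exI[of _ "p * q"]) simp
qed

text \<open>
  The product of Grassmannians is irreducible because it is parametrised by frames, that is by an
  affine space. Concretely, join two frames by a line: along it both functions are polynomials in one
  variable, nonzero at \<open>0\<close> respectively at \<open>1\<close>, and have finitely many zeros.
\<close>

lemma bivectors_irreducible:
  assumes inf: "infinite (UNIV :: 'k set)"
    and F: "F \<in> poly_funs sW r" "F (bivectors x y) \<noteq> 0"
    and G: "G \<in> poly_funs sW r" "G (bivectors x' y') \<noteq> 0"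
  obtains x'' y'' where "F (bivectors x'' y'') \<noteq> 0" "G (bivectors x'' y'') \<noteq> 0"
proof -
  let ?w = "\<lambda>t. bivectors (\<lambda>i. x i + sV t (x' i - x i)) (\<lambda>i. y i + sV t (y' i - y i))"
  obtain p where p: "\<And>t. F (?w t) = poly p t"
    using poly_funs_along_line[OF F(1), where x' = "\<lambda>i. x' i - x i" and y' = "\<lambda>i. y' i - y i"] by blast
  obtain q where q: "\<And>t. G (?w t) = poly q t"
    using poly_funs_along_line[OF G(1), where x' = "\<lambda>i. x' i - x i" and y' = "\<lambda>i. y' i - y i"] by blast
  have "poly p 0 \<noteq> 0" "poly q 1 \<noteq> 0"
    using F(2) G(2) by (simp_all flip: p q)
  hence "p * q \<noteq> 0" by auto
  hence fin: "finite {t. poly (p * q) t = 0}" by (rule poly_roots_finite)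
  have "{t. poly (p * q) t = 0} \<noteq> UNIV"
  proof
    assume "{t. poly (p * q) t = 0} = UNIV"
    with fin inf show False by (simp only:)
  qed
  then obtain t where "poly (p * q) t \<noteq> 0" by blast
  hence "F (?w t) \<noteq> 0" "G (?w t) \<noteq> 0" unfolding p q by auto
  thus ?thesis by (rule that)
qed

lemma bivectors_irreducible_finite:
  assumes inf: "infinite (UNIV :: 'k set)" and "finite A"
    and "\<And>F. F \<in> A \<Longrightarrow> F \<in> poly_funs sW r"
    and "\<And>F. F \<in> A \<Longrightarrow> \<exists>x y. F (bivectors x y) \<noteq> 0"
  shows "\<exists>x y. \<forall>F\<in>A. F (bivectors x y) \<noteq> 0"
  using assms(2-)
proof (induction A rule: finite_induct)
  case (insert F A)
  then obtain x y where A: "\<forall>F\<in>A. F (bivectors x y) \<noteq> 0" by blast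
  obtain x' y' where F: "F (bivectors x' y') \<noteq> 0" using insert.prems by blast
  have "(\<lambda>w. \<Prod>G\<in>A. G w) \<in> poly_funs sW r"
    by (rule poly_funs_prod) (use insert.prems in auto)
  moreover have "(\<Prod>G\<in>A. G (bivectors x y)) \<noteq> 0" using A insert.hyps by simp
  moreover have "F \<in> poly_funs sW r" using insert.prems by blast
  ultimately obtain x'' y'' where
    "(\<Prod>G\<in>A. G (bivectors x'' y'')) \<noteq> 0" "F (bivectors x'' y'') \<noteq> 0"
    using bivectors_irreducible[OF inf, of "\<lambda>w. \<Prod>G\<in>A. G w" r x y F x' y'] F by blast
  thus ?case using insert.hyps by auto
qed simp

section \<open>Counting dimensions\<close>

lemma basis_enumeration:
  assumes "V.dim UNIV = d" "0 < d"
  obtains e where "independent_family sV e {..<d}" "V.span (e ` {..<d}) = UNIV"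
proof -
  obtain B where B: "B \<subseteq> UNIV" "V.independent B" "UNIV \<subseteq> V.span B" "card B = V.dim UNIV"
    by (rule V.basis_exists)
  have "finite B" using B(4) assms by (metis card.infinite less_irrefl)
  then obtain e where "bij_betw e {..<d} B"
    using ex_bij_betw_nat_finite[of B] B(4) assms(1) by (metis atLeast0LessThan)
  with B show ?thesis
    by (intro that[of e])
      (auto simp: independent_family_iff[OF V.vector_space_axioms] bij_betw_def)
qed

text \<open>
  The necessary dimension count. With a basis \<open>B\<close> of \<open>V\<close> that extends \<open>x i, y i\<close>, the space \<open>V \<and> L\<^sub>i\<close> is
  spanned by \<open>(d - 1) + (d - 2)\<close> bivectors. The bivector \<open>x i \<and> y i\<close> is one of them, so the
  bivectors of the tuple contribute only \<open>r - 1\<close> more, and together they must span a space of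
  dimension \<open>d choose 2 = (d - 2 choose 2) + (d - 2) + (d - 1)\<close>.
\<close>

lemma submersion_bound:
  assumes d: "V.dim UNIV = d" "2 \<le> d" and nz: "bivectors x y i \<noteq> 0" and i: "i < r"
    and span: "W.span (osculating (x i) (y i) \<union> bivectors x y ` {..<r}) = UNIV"
  shows "(d - 2 choose 2) + 1 \<le> r"
proof -
  define a b where "a = x i" and "b = y i"
  have ab: "a \<noteq> b" "V.independent {a, b}"
    using nz by (simp_all add: a_def b_def bivectors_def wedge_nonzero_iff)
  obtain B where B: "{a, b} \<subseteq> B" "V.independent B" "UNIV \<subseteq> V.span B"
    using V.maximal_independent_subset_extend[of "{a, b}" UNIV] ab(2) by auto
  have cardB: "card B = d" using V.basis_card_eq_dim[of B UNIV] B d(1) by simp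
  have finB: "finite B" using cardB d(2) by (metis card.infinite not_numeral_le_zero)
  define T where "T = wedge a ` (B - {a}) \<union> wedge b ` (B - {a, b}) \<union> bivectors x y ` ({..<r} - {i})"
  have finT: "finite T" by (simp add: T_def finB)
  have Ta: "wedge a c \<in> W.span T" if "c \<in> B" for c
    using that by (cases "c = a") (auto simp: T_def W.span_zero intro!: W.span_base)
  have Tb: "wedge b c \<in> W.span T" if "c \<in> B" for c
  proof -
    consider "c = a" | "c = b" | "c \<notin> {a, b}" by blast
    thus ?thesis
    proof cases
      case 1
      thus ?thesis using W.span_neg[OF Ta[of b]] B(1) by (simp add: wedge_skew[of b])
    qed (use that in \<open>auto simp: T_def W.span_zero intro!: W.span_base\<close>)
  qed
  have "wedge z v \<in> W.span T" if "v \<in> V.span {a, b}" for z v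
  proof (rule wedge_in_subspace[OF W.subspace_span _ _ that])
    show "z \<in> V.span B" using B(3) by blast
    fix c c' assume "c \<in> B" "c' \<in> {a, b}"
    thus "wedge c c' \<in> W.span T"
      using W.span_neg[OF Ta[of c]] W.span_neg[OF Tb[of c]] by (auto simp: wedge_skew[of c])
  qed
  hence "osculating a b \<subseteq> W.span T" by (auto simp: osculating_def)
  moreover have "bivectors x y j \<in> W.span T" if "j < r" for j
  proof (cases "j = i")
    case True
    thus ?thesis using Ta[of b] B(1) by (simp add: bivectors_def a_def b_def)
  next
    case False
    thus ?thesis using that by (intro W.span_base) (simp add: T_def)
  qed
  ultimately have "W.span (osculating a b \<union> bivectors x y ` {..<r}) \<subseteq> W.span T"
    by (intro W.span_minimal W.subspace_span) auto
  hence "W.dim UNIV \<le> card T"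
    using span finT by (intro W.dim_le_card) (simp_all add: a_def b_def)
  also have "card T \<le> card (B - {a}) + card (B - {a, b}) + card ({..<r} - {i})"
    unfolding T_def
    by (intro order_trans[OF card_Un_le] add_mono card_image_le) (simp_all add: finB)
  also have "\<dots> = (d - 1) + (d - 2) + (r - 1)"
    using B(1) ab(1) i finB by (simp add: cardB card_Diff_subset)
  finally have le: "W.dim UNIV \<le> (d - 1) + (d - 2) + (r - 1)" .
  obtain e where "independent_family sV e {..<d}" "V.span (e ` {..<d}) = UNIV"
    using basis_enumeration[OF d(1)] d(2) by auto
  hence "W.dim UNIV = d choose 2" by (rule dim_W)
  moreover obtain k where "d = Suc (Suc k)" using d(2) by (metis add_2_eq_Suc le_Suc_ex)
  hence "d choose 2 = (d - 2 choose 2) + (d - 2) + (d - 1)" by (simp add: numeral_2_eq_2)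
  ultimately show ?thesis using le i by linarith
qed

lemma independent_configuration:
  assumes e: "independent_family sV e {..<d}" and r: "r \<le> d choose 2"
  obtains x y where "independent_family sW (bivectors x y) {..<r}"
proof -
  obtain p where p: "p ` {..<r} \<subseteq> increasing_pairs d" "inj_on p {..<r}"
    using card_le_inj[of "{..<r}" "increasing_pairs d"] r
    by (auto simp: finite_increasing_pairs card_increasing_pairs)
  let ?w = "\<lambda>(a, b). wedge (e a) (e b)"
  have w: "inj_on ?w (increasing_pairs d)" "W.independent (?w ` increasing_pairs d)"
    using independent_family_wedge[OF e]
    by (simp_all add: independent_family_iff[OF W.vector_space_axioms finite_increasing_pairs])
  have "inj_on (?w \<circ> p) {..<r}"
    using p w(1) by (intro comp_inj_on) (auto intro: inj_on_subset)
  moreover have "W.independent ((?w \<circ> p) ` {..<r})"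
    using w(2) p(1) unfolding image_comp[symmetric] by (rule W.independent_mono[OF _ image_mono])
  ultimately have "independent_family sW (?w \<circ> p) {..<r}"
    by (simp add: independent_family_iff[OF W.vector_space_axioms])
  moreover have "?w \<circ> p = bivectors (\<lambda>i. e (fst (p i))) (\<lambda>i. e (snd (p i)))"
    by (auto simp: bivectors_def case_prod_beta)
  ultimately show ?thesis using that by simp
qed

text \<open>
  The bound suffices for one index \<open>i\<close> at a time: put \<open>L\<^sub>i = \<langle>e\<^sub>0, e\<^sub>1\<rangle>\<close>, so that \<open>V \<and> L\<^sub>i\<close> contains all
  \<open>e\<^sub>a \<and> e\<^sub>b\<close> with \<open>a < 2\<close>, and let the remaining \<open>r - 1\<close> planes run through the \<open>\<langle>e\<^sub>a, e\<^sub>b\<rangle>\<close> with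
  \<open>2 \<le> a < b < d\<close>. Different \<open>i\<close> use different configurations; irreducibility combines them.
\<close>

lemma spanning_configuration:
  assumes e: "independent_family sV e {..<d}" "V.span (e ` {..<d}) = UNIV"
    and d: "2 \<le> d" and r: "(d - 2 choose 2) + 1 \<le> r" and i: "i < r"
  obtains x y where "bivectors x y i \<noteq> 0"
    and "W.span (osculating (x i) (y i) \<union> bivectors x y ` {..<r}) = UNIV"
proof -
  let ?P = "increasing_pairs (d - 2)"
  have "card ?P \<le> card ({..<r} - {i})"
    using r i by (simp add: card_increasing_pairs)
  then obtain h where h: "h ` ?P \<subseteq> {..<r} - {i}" "inj_on h ?P"
    using card_le_inj[OF finite_increasing_pairs, of "{..<r} - {i}"] by auto
  \<comment> \<open>The shift by \<open>2\<close> moves the pairs below \<open>d - 2\<close> to the pairs in \<open>{2..<d}\<close>. Outside the range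
    of \<open>h\<close> the vectors are arbitrary and may even be dependent: only the span matters.\<close>
  define x where "x j = (if j = i then e 0 else e (fst (inv_into ?P h j) + 2))" for j
  define y where "y j = (if j = i then e 1 else e (snd (inv_into ?P h j) + 2))" for j
  let ?S = "W.span (osculating (x i) (y i) \<union> bivectors x y ` {..<r})"
  have osc: "wedge z v \<in> ?S" if "v \<in> {e 0, e 1}" for z v
    using that by (intro W.span_base) (auto simp: osculating_def x_def y_def intro!: V.span_base)
  have "wedge (e a) (e b) \<in> ?S" if "a < b" "b < d" for a b
  proof (cases "a < 2")
    case True
    hence "wedge (e b) (e a) \<in> ?S" by (intro osc) (auto simp: less_2_cases_iff)
    thus ?thesis using W.span_neg by (subst wedge_skew) blast
  next
    case False
    hence p: "(a - 2, b - 2) \<in> ?P" using that by (auto simp: increasing_pairs_def)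
    define j where "j = h (a - 2, b - 2)"
    have j: "j < r" "j \<noteq> i" using h(1) p by (auto simp: j_def)
    have "inv_into ?P h j = (a - 2, b - 2)"
      unfolding j_def using h(2) p by (rule inv_into_f_f)
    moreover have "Suc (Suc (a - 2)) = a" "Suc (Suc (b - 2)) = b" using False that by auto
    ultimately have "bivectors x y j = wedge (e a) (e b)"
      using j by (simp add: bivectors_def x_def y_def)
    moreover have "bivectors x y j \<in> ?S" using j(1) by (intro W.span_base) simp
    ultimately show ?thesis by simp
  qed
  hence "(\<lambda>(a, b). wedge (e a) (e b)) ` increasing_pairs d \<subseteq> ?S"
    by (auto simp: increasing_pairs_def)
  hence "W.span ((\<lambda>(a, b). wedge (e a) (e b)) ` increasing_pairs d) \<subseteq> ?S"
    by (rule W.span_minimal) (rule W.subspace_span)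
  hence "?S = UNIV" using span_wedge_basis[OF e(2)] by blast
  moreover have "e 0 \<noteq> e 1 \<and> V.independent {e 0, e 1}"
  proof -
    have inj: "inj_on e {..<d}" and ind: "V.independent (e ` {..<d})"
      using e(1) by (simp_all add: independent_family_iff[OF V.vector_space_axioms])
    have "e 0 \<noteq> e 1" using inj_onD[OF inj, of 0 1] d by auto
    moreover have "V.independent {e 0, e 1}" using d by (intro V.independent_mono[OF ind]) auto
    ultimately show ?thesis ..
  qed
  hence "bivectors x y i \<noteq> 0" by (simp add: bivectors_def x_def y_def wedge_nonzero_iff)
  ultimately show ?thesis using that by blast
qed

text \<open>
  The submersion criterion at an index, as the nonvanishing of one multihomogeneous polynomial in the
  Pluecker vectors. The polynomial depends on the point near which it is used, but it certifies the
  criterion wherever neither it nor the bivector \<open>x i \<and> y i\<close> vanishes.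
\<close>

lemma spanning_polynomial:
  assumes fin: "finite T" "W.span T = UNIV" and i: "i < r" and nz: "bivectors x y i \<noteq> 0"
    and span: "W.span (osculating (x i) (y i) \<union> bivectors x y ` {..<r}) = UNIV"
  obtains F where "F \<in> poly_funs sW r" "multihomogeneous sW r F" "F (bivectors x y) \<noteq> 0"
    and "\<And>x y. F (bivectors x y) \<noteq> 0 \<Longrightarrow> bivectors x y i \<noteq> 0 \<Longrightarrow>
      W.span (osculating (x i) (y i) \<union> bivectors x y ` {..<r}) = UNIV"
proof -
  have "W.span ((\<lambda>(T, j). T (bivectors x y j)) ` columns r i) = UNIV"
    using span_columns[OF nz] span by simp
  from spanning_minor[OF W.vector_space_axioms columns_linear[OF _ i] fin this]
  obtain F where F: "F \<in> poly_funs sW r" "multihomogeneous sW r F" "F (bivectors x y) \<noteq> 0"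
    and cols: "\<And>w. F w \<noteq> 0 \<Longrightarrow> W.span ((\<lambda>(T, j). T (w j)) ` columns r i) = UNIV"
    by blast
  show ?thesis
    by (rule that[OF F]) (use cols span_columns in blast)
qed

section \<open>Generic submersivity\<close>

text \<open>
  For small \<open>r\<close> no point of the domain is a point of submersion, while a dense subset of the nonempty
  domain has points. For large \<open>r\<close> the set of all submersion points is open by
  \<open>spanning_polynomial\<close>. It meets every nonempty open set: the finitely many polynomials that
  describe the open set, the domain and the criterion at each index have a common non-zero.
\<close>

lemma generic_submersion_iff:
  assumes inf: "infinite (UNIV :: 'k set)"
    and d: "V.dim UNIV = d" "2 \<le> d" and r: "1 \<le> r" "r \<le> d choose 2"
  defines "X \<equiv> subtopology (Zariski r) (Psi_domain sV sW wedge r)"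
  shows "(\<exists>U. openin X U \<and> X closure_of U = Psi_domain sV sW wedge r \<and>
      (\<forall>L\<in>U. Psi_submersion_at sV sW wedge r L)) \<longleftrightarrow> (d - 2 choose 2) + 1 \<le> r"
proof -
  let ?dom = "Psi_domain sV sW wedge r"
  let ?spans = "\<lambda>x y i. W.span (osculating (x i) (y i) \<union> bivectors x y ` {..<r}) = UNIV"
  have top: "topspace X = ?dom"
    by (auto simp: X_def topspace_Zariski Psi_domain_def)
  obtain e where e: "independent_family sV e {..<d}" "V.span (e ` {..<d}) = UNIV"
    using basis_enumeration[OF d(1)] d(2) by auto
  have fin: "finite ((\<lambda>(a, b). wedge (e a) (e b)) ` increasing_pairs d)"
    by (simp add: finite_increasing_pairs)
  note spanning_polynomial = spanning_polynomial[OF fin span_wedge_basis[OF e(2)]]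
  have in_dom: "planes r x y \<in> ?dom" if "independent_family sW (bivectors x y) {..<r}" for x y
    using planes_in_domain_iff[of r x y] independent_bivectors_nonzero[OF that] that by blast
  show ?thesis
  proof
    assume "\<exists>U. openin X U \<and> X closure_of U = ?dom \<and> (\<forall>L\<in>U. Psi_submersion_at sV sW wedge r L)"
    then obtain U where U: "openin X U" "X closure_of U = ?dom"
      "\<forall>L\<in>U. Psi_submersion_at sV sW wedge r L" by blast
    obtain x0 y0 where "independent_family sW (bivectors x0 y0) {..<r}"
      using independent_configuration[OF e(1) r(2)] by blast
    hence "?dom \<noteq> {}" using in_dom by blast
    hence "U \<noteq> {}" using U(2) by (metis closure_of_empty)
    then obtain L where L: "L \<in> U" "L \<in> ?dom" using openin_subset[OF U(1)] top by blast
    obtain x y where xy: "L = planes r x y" "independent_family sW (bivectors x y) {..<r}"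
      using Psi_domainE[OF L(2)] by blast
    have "?spans x y 0"
      using submersion_iff[OF xy(2)] U(3) L(1) xy(1) r(1) by auto
    thus "(d - 2 choose 2) + 1 \<le> r"
      using submersion_bound[OF d independent_bivectors_nonzero[OF xy(2)], of 0] r(1) by auto
  next
    assume large: "(d - 2 choose 2) + 1 \<le> r"
    define U where "U = {L \<in> ?dom. Psi_submersion_at sV sW wedge r L}"
    have U_I: "planes r x y \<in> U"
      if "independent_family sW (bivectors x y) {..<r}" "\<forall>i<r. ?spans x y i" for x y
      using submersion_iff[OF that(1)] in_dom[OF that(1)] that(2) by (simp add: U_def)
    have "openin X U"
    proof (subst openin_subopen, rule ballI)
      fix L assume L: "L \<in> U"
      then obtain x y where xy: "L = planes r x y" "independent_family sW (bivectors x y) {..<r}"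
        unfolding U_def using Psi_domainE by blast
      have nz: "bivectors x y i \<noteq> 0" if "i < r" for i
        using independent_bivectors_nonzero[OF xy(2) that] .
      have spans: "?spans x y i" if "i < r" for i
        using L submersion_iff[OF xy(2)] xy(1) that by (simp add: U_def)
      have "\<forall>i. \<exists>F. i < r \<longrightarrow> F \<in> poly_funs sW r \<and> multihomogeneous sW r F \<and>
          F (bivectors x y) \<noteq> 0 \<and>
          (\<forall>x y. F (bivectors x y) \<noteq> 0 \<longrightarrow> bivectors x y i \<noteq> 0 \<longrightarrow> ?spans x y i)"
      proof
        fix i
        show "\<exists>F. i < r \<longrightarrow> F \<in> poly_funs sW r \<and> multihomogeneous sW r F \<and>
          F (bivectors x y) \<noteq> 0 \<and>
          (\<forall>x y. F (bivectors x y) \<noteq> 0 \<longrightarrow> bivectors x y i \<noteq> 0 \<longrightarrow> ?spans x y i)"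
        proof (cases "i < r")
          case True
          show ?thesis
            by (rule spanning_polynomial[OF True nz[OF True] spans[OF True]]) blast
        qed simp
      qed
      from choice[OF this] obtain F where F: "\<And>i. i < r \<Longrightarrow> F i \<in> poly_funs sW r"
        "\<And>i. i < r \<Longrightarrow> multihomogeneous sW r (F i)" "\<And>i. i < r \<Longrightarrow> F i (bivectors x y) \<noteq> 0"
        and F_spans: "\<And>i x y. i < r \<Longrightarrow> F i (bivectors x y) \<noteq> 0 \<Longrightarrow> bivectors x y i \<noteq> 0 \<Longrightarrow>
          ?spans x y i"
        by blast
      define G where "G w = (\<Prod>i<r. F i w)" for w
      have G: "G \<in> poly_funs sW r" "multihomogeneous sW r G"
        unfolding G_def[abs_def] using F(1,2)
        by (auto intro!: poly_funs_prod multihomogeneous_prod)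
      have "openin X (?dom \<inter> basic_open r G)"
        unfolding X_def by (intro openin_subtopology_Int2 openin_basic_open G)
      moreover have "L \<in> ?dom \<inter> basic_open r G"
        using planes_in_basic_open_iff[OF G nz] F(3) in_dom[OF xy(2)] xy(1) by (simp add: G_def)
      moreover have "?dom \<inter> basic_open r G \<subseteq> U"
      proof
        fix L' assume L': "L' \<in> ?dom \<inter> basic_open r G"
        then obtain x' y' where xy': "L' = planes r x' y'"
          "independent_family sW (bivectors x' y') {..<r}"
          using Psi_domainE by blast
        have nz': "bivectors x' y' i \<noteq> 0" if "i < r" for i
          using independent_bivectors_nonzero[OF xy'(2) that] .
        have "G (bivectors x' y') \<noteq> 0"
          using planes_in_basic_open_iff[OF G nz'] L' xy'(1) by blast
        hence "\<forall>i<r. F i (bivectors x' y') \<noteq> 0" by (simp add: G_def)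
        thus "L' \<in> U" using U_I[OF xy'(2)] F_spans nz' xy'(1) by blast
      qed
      ultimately show "\<exists>T. openin X T \<and> L \<in> T \<and> T \<subseteq> U" by blast
    qed
    moreover have "X closure_of U = topspace X"
      unfolding dense_intersects_open
    proof (intro allI impI, elim conjE)
      fix T assume T: "openin X T" "T \<noteq> {}"
      then obtain S where S: "openin (Zariski r) S" "T = S \<inter> ?dom"
        by (auto simp: X_def openin_subtopology)
      then obtain L where L: "L \<in> S" "L \<in> ?dom" using T(2) by blast
      obtain x y where xy: "L = planes r x y" "independent_family sW (bivectors x y) {..<r}"
        using Psi_domainE[OF L(2)] by blast
      obtain F where F: "F \<in> poly_funs sW r" "multihomogeneous sW r F"
        "L \<in> basic_open r F" "basic_open r F \<subseteq> S"
        using Zariski_nbhd[OF S(1) L(1)] by blast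
      have F0: "F (bivectors x y) \<noteq> 0"
        using planes_in_basic_open_iff[OF F(1,2) independent_bivectors_nonzero[OF xy(2)]] F(3) xy(1)
        by blast
      obtain H where H: "H \<in> poly_funs sW r" "H (bivectors x y) \<noteq> 0"
        and H_ind: "\<And>w. H w \<noteq> 0 \<Longrightarrow> independent_family sW w {..<r}"
        using independence_minor[OF W.vector_space_axioms, of r "\<lambda>_ w. w" "\<lambda>c. c" r "bivectors x y"]
          W.linear_ident xy(2) by auto
      have "\<forall>i. \<exists>F. i < r \<longrightarrow> F \<in> poly_funs sW r \<and> (\<exists>x y. F (bivectors x y) \<noteq> 0) \<and>
          (\<forall>x y. F (bivectors x y) \<noteq> 0 \<longrightarrow> bivectors x y i \<noteq> 0 \<longrightarrow> ?spans x y i)"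
      proof
        fix i
        show "\<exists>F. i < r \<longrightarrow> F \<in> poly_funs sW r \<and> (\<exists>x y. F (bivectors x y) \<noteq> 0) \<and>
          (\<forall>x y. F (bivectors x y) \<noteq> 0 \<longrightarrow> bivectors x y i \<noteq> 0 \<longrightarrow> ?spans x y i)"
        proof (cases "i < r")
          case True
          obtain x' y' where "bivectors x' y' i \<noteq> 0" "?spans x' y' i"
            using spanning_configuration[OF e d(2) large True] by blast
          thus ?thesis by (rule spanning_polynomial[OF True]) blast
        qed simp
      qed
      from choice[OF this] obtain G where G: "\<And>i. i < r \<Longrightarrow> G i \<in> poly_funs sW r"
        "\<And>i. i < r \<Longrightarrow> \<exists>x y. G i (bivectors x y) \<noteq> 0"
        and G_spans: "\<And>i x y. i < r \<Longrightarrow> G i (bivectors x y) \<noteq> 0 \<Longrightarrow> bivectors x y i \<noteq> 0 \<Longrightarrow>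
          ?spans x y i"
        by blast
      have "\<exists>x y. \<forall>P\<in>{F, H} \<union> G ` {..<r}. P (bivectors x y) \<noteq> 0"
      proof (rule bivectors_irreducible_finite[OF inf])
        show "P \<in> poly_funs sW r" if "P \<in> {F, H} \<union> G ` {..<r}" for P
          using that F(1) H(1) G(1) by auto
        show "\<exists>x y. P (bivectors x y) \<noteq> 0" if "P \<in> {F, H} \<union> G ` {..<r}" for P
          using that F0 H(2) G(2) by auto
      qed simp
      then obtain x' y' where nz': "F (bivectors x' y') \<noteq> 0" "H (bivectors x' y') \<noteq> 0"
        "\<And>i. i < r \<Longrightarrow> G i (bivectors x' y') \<noteq> 0" by auto
      have ind: "independent_family sW (bivectors x' y') {..<r}" by (rule H_ind[OF nz'(2)])
      note biv = independent_bivectors_nonzero[OF ind]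
      have "planes r x' y' \<in> U" using U_I[OF ind] G_spans nz'(3) biv by blast
      moreover have "planes r x' y' \<in> basic_open r F"
        using planes_in_basic_open_iff[OF F(1,2) biv] nz'(1) by blast
      hence "planes r x' y' \<in> T" using S(2) F(4) in_dom[OF ind] by blast
      ultimately show "U \<inter> T \<noteq> {}" by blast
    qed
    ultimately show "\<exists>U. openin X U \<and> X closure_of U = ?dom \<and>
        (\<forall>L\<in>U. Psi_submersion_at sV sW wedge r L)"
      unfolding top by (intro exI[of _ U]) (simp add: U_def)
  qed
qed

end

theorem theorem4p5p1:
  fixes sV :: "'p::prime_card padic \<Rightarrow> 'v::ab_group_add \<Rightarrow> 'v"
    and sW :: "'p padic \<Rightarrow> 'w::ab_group_add \<Rightarrow> 'w"
    and wedge :: "'v \<Rightarrow> 'v \<Rightarrow> 'w"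
    and d r :: nat
  assumes "CARD('p) > 3"
    and "vector_space sV"
    and "vector_space.dim sV UNIV = d"
    and "d \<ge> 2"
    and "exterior_square sV sW wedge"
    and "1 \<le> r"
    and "r \<le> d choose 2"
  shows "(\<exists>U.
      openin (subtopology (zariski_Gr2_power sV sW wedge r) (Psi_domain sV sW wedge r)) U \<and>
      subtopology (zariski_Gr2_power sV sW wedge r) (Psi_domain sV sW wedge r) closure_of U
        = Psi_domain sV sW wedge r \<and>
      (\<forall>L\<in>U. Psi_submersion_at sV sW wedge r L))
    \<longleftrightarrow> r \<ge> (d - 2 choose 2) + 1"
  using exterior_square.generic_submersion_iff[OF assms(5) infinite_padic assms(3,4,6,7)] .

end
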